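(* Let $\mathbf{K}$ be a compactly generated tensor triangulated category, $X$ a Zariski space, $\mathcal{X}_{cl}$ the collection of closed subsets of $X$, and $V:\mathbf{K}^c\to\mathcal{X}_{cl}$ a quasi support data defined on $\mathbf{K}^c$. Suppose that (i) for every $M\in\mathbf{K}^c$ one has $\mathbf{I}_{V(M)}=\operatorname{Tensor}(M)$, and (ii) for every $W\in\mathcal{X}_{cl}$ there is an $M\in\mathbf{K}^c$ with $V(M)=W$. Then $V(M\otimes N)=V(M)\cap V(N)$ for any $M$ and $N$ in $\mathbf{K}^c$.
   Context: A tensor triangulated category (TTC) is a triangulated category $\mathbf{K}$ with a braided monoidal tensor product $\otimes$, exact in each variable, with unit $\mathbf{1}$. $\mathbf{K}^c$ is the full triangulated subcategory of compact objects. $\mathbf{K}$ is a compactly generated TTC if it has arbitrary set-indexed coproducts, $\otimes$ preserves them, $\mathbf{K}$ is compactly generated, tensor products of compact objects are compact, $\mathbf{1}$ is compact, and every compact object is rigid (strongly dualizable), so there is an exact duality $(-)^*$ on $\mathbf{K}^c$. A Zariski space is a Noetherian topological space in which every irreducible closed set has a unique generic point. A quasi support data $V:\mathbf{K}^c\to\mathcal{X}_{cl}$ is an assignment with: (1) $V(0)=\varnothing$, $V(\mathbf{1})=X$; (2) $V(\bigoplus_{i\in I}M_i)=\bigcup_{i\in I}V(M_i)$ whenever $\bigoplus_{i\in I}M_i$ is an object of $\mathbf{K}^c$; (3) $V(\Sigma M)=V(M)$, $\Sigma$ the shift; (4) $V(N)\subseteq V(M)\cup V(Q)$ for any distinguished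 triangle $M\to N\to Q\to\Sigma M$; (5) $V(M\otimes N)\subseteq V(M)\cap V(N)$. A tensor ideal of $\mathbf{K}^c$ is a triangulated subcategory closed under tensoring with arbitrary objects of $\mathbf{K}^c$; it is thick if closed under direct summands. $\operatorname{Tensor}(M)$ is the thick tensor ideal of $\mathbf{K}^c$ generated by $M$, and for $W\subseteq X$, $\mathbf{I}_W=\{Q\in\mathbf{K}^c\mid V(Q)\subseteq W\}$. *)

theory Defs
  imports "HOL-Algebra.Free_Abelian_Groups" "HOL-Analysis.Abstract_Topology"
begin

section \<open>Categories\<close>

record ('o, 'm) category_data =
  ob :: "'o set"
  ar :: "'m set"
  src :: "'m \<Rightarrow> 'o"
  tgt :: "'m \<Rightarrow> 'o"
  ide :: "'o \<Rightarrow> 'm"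
  cmp :: "'m \<Rightarrow> 'm \<Rightarrow> 'm" (infixr "\<cdot>\<index>" 70)

definition Hom :: "('o, 'm, 'z) category_data_scheme \<Rightarrow> 'o \<Rightarrow> 'o \<Rightarrow> 'm set" where
  "Hom K A B = {f \<in> ar K. src K f = A \<and> tgt K f = B}"

locale category =
  fixes K :: "('o, 'm, 'z) category_data_scheme" (structure)
  assumes src_ob: "f \<in> ar K \<Longrightarrow> src K f \<in> ob K"
    and tgt_ob: "f \<in> ar K \<Longrightarrow> tgt K f \<in> ob K"
    and ide_Hom: "A \<in> ob K \<Longrightarrow> ide K A \<in> Hom K A A"
    and cmp_Hom: "f \<in> Hom K A B \<Longrightarrow> g \<in> Hom K B C \<Longrightarrow> g \<cdot> f \<in> Hom K A C"
    and cmp_assoc: "f \<in> Hom K A B \<Longrightarrow> g \<in> Hom K B C \<Longrightarrow> h \<in> Hom K C D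
      \<Longrightarrow> (h \<cdot> g) \<cdot> f = h \<cdot> (g \<cdot> f)"
    and cmp_ide_right: "f \<in> Hom K A B \<Longrightarrow> f \<cdot> ide K A = f"
    and cmp_ide_left: "f \<in> Hom K A B \<Longrightarrow> ide K B \<cdot> f = f"

definition inverse_arrows :: "('o, 'm, 'z) category_data_scheme \<Rightarrow> 'm \<Rightarrow> 'm \<Rightarrow> bool" where
  "inverse_arrows K f g \<longleftrightarrow>
     f \<in> ar K \<and> g \<in> Hom K (tgt K f) (src K f) \<and>
     g \<cdot>\<^bsub>K\<^esub> f = ide K (src K f) \<and> f \<cdot>\<^bsub>K\<^esub> g = ide K (tgt K f)"

definition is_iso :: "('o, 'm, 'z) category_data_scheme \<Rightarrow> 'm \<Rightarrow> bool" where
  "is_iso K f \<longleftrightarrow> (\<exists>g. inverse_arrows K f g)"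

definition inv_ar :: "('o, 'm, 'z) category_data_scheme \<Rightarrow> 'm \<Rightarrow> 'm" where
  "inv_ar K f = (THE g. inverse_arrows K f g)"

definition isomorphic :: "('o, 'm, 'z) category_data_scheme \<Rightarrow> 'o \<Rightarrow> 'o \<Rightarrow> bool" where
  "isomorphic K A B \<longleftrightarrow> (\<exists>f \<in> Hom K A B. is_iso K f)"

definition zero_object :: "('o, 'm, 'z) category_data_scheme \<Rightarrow> 'o \<Rightarrow> bool" where
  "zero_object K Z \<longleftrightarrow>
     Z \<in> ob K \<and> (\<forall>A \<in> ob K. (\<exists>!f. f \<in> Hom K Z A) \<and> (\<exists>!f. f \<in> Hom K A Z))"

text \<open>\<open>S\<close> is the coproduct of the family \<open>X\<close> over the index set \<open>I\<close>, with injections \<open>\<iota>\<close>.\<close>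

definition coproduct ::
  "('o, 'm, 'z) category_data_scheme \<Rightarrow> 'i set \<Rightarrow> ('i \<Rightarrow> 'o) \<Rightarrow> 'o \<Rightarrow> ('i \<Rightarrow> 'm) \<Rightarrow> bool" where
  "coproduct K I X S \<iota> \<longleftrightarrow>
     S \<in> ob K \<and> (\<forall>i \<in> I. X i \<in> ob K \<and> \<iota> i \<in> Hom K (X i) S) \<and>
     (\<forall>Y \<in> ob K. \<forall>g. (\<forall>i \<in> I. g i \<in> Hom K (X i) Y) \<longrightarrow>
        (\<exists>!u. u \<in> Hom K S Y \<and> (\<forall>i \<in> I. u \<cdot>\<^bsub>K\<^esub> \<iota> i = g i)))"

definition endofunctor ::
  "('o, 'm, 'z) category_data_scheme \<Rightarrow> ('o \<Rightarrow> 'o) \<Rightarrow> ('m \<Rightarrow> 'm) \<Rightarrow> bool" where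
  "endofunctor K Fo Fa \<longleftrightarrow>
     (\<forall>A \<in> ob K. Fo A \<in> ob K \<and> Fa (ide K A) = ide K (Fo A)) \<and>
     (\<forall>A B. \<forall>f \<in> Hom K A B. Fa f \<in> Hom K (Fo A) (Fo B)) \<and>
     (\<forall>A B C. \<forall>f \<in> Hom K A B. \<forall>g \<in> Hom K B C. Fa (g \<cdot>\<^bsub>K\<^esub> f) = Fa g \<cdot>\<^bsub>K\<^esub> Fa f)"

definition natural_iso ::
  "('o, 'm, 'z) category_data_scheme \<Rightarrow> ('o \<Rightarrow> 'o) \<Rightarrow> ('m \<Rightarrow> 'm)
     \<Rightarrow> ('o \<Rightarrow> 'o) \<Rightarrow> ('m \<Rightarrow> 'm) \<Rightarrow> ('o \<Rightarrow> 'm) \<Rightarrow> bool" where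
  "natural_iso K Fo Fa Go Ga \<theta> \<longleftrightarrow>
     (\<forall>A \<in> ob K. \<theta> A \<in> Hom K (Fo A) (Go A) \<and> is_iso K (\<theta> A)) \<and>
     (\<forall>A B. \<forall>f \<in> Hom K A B. \<theta> B \<cdot>\<^bsub>K\<^esub> Fa f = Ga f \<cdot>\<^bsub>K\<^esub> \<theta> A)"


section \<open>Additive categories\<close>

record ('o, 'm) additive_data = "('o, 'm) category_data" +
  zero_ar :: "'o \<Rightarrow> 'o \<Rightarrow> 'm"
  add_ar :: "'m \<Rightarrow> 'm \<Rightarrow> 'm" (infixl "\<boxplus>\<index>" 65)

text \<open>The abelian group of arrows from \<open>A\<close> to \<open>B\<close>. Being a monoid record of the library, it is
  written multiplicatively there: its product is the sum of arrows and its unit the zero arrow.\<close>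

definition hom_group :: "('o, 'm, 'z) additive_data_scheme \<Rightarrow> 'o \<Rightarrow> 'o \<Rightarrow> 'm monoid" where
  "hom_group K A B = \<lparr>carrier = Hom K A B, monoid.mult = add_ar K, one = zero_ar K A B\<rparr>"

definition neg_ar :: "('o, 'm, 'z) additive_data_scheme \<Rightarrow> 'm \<Rightarrow> 'm" where
  "neg_ar K f = inv\<^bsub>hom_group K (src K f) (tgt K f)\<^esub> f"

definition biproduct :: "('o, 'm, 'z) additive_data_scheme \<Rightarrow> 'o \<Rightarrow> 'o \<Rightarrow> 'o \<Rightarrow> bool" where
  "biproduct K A B S \<longleftrightarrow>
     A \<in> ob K \<and> B \<in> ob K \<and> S \<in> ob K \<and>
     (\<exists>i \<in> Hom K A S. \<exists>j \<in> Hom K B S. \<exists>p \<in> Hom K S A. \<exists>q \<in> Hom K S B.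
        p \<cdot>\<^bsub>K\<^esub> i = ide K A \<and> q \<cdot>\<^bsub>K\<^esub> j = ide K B \<and>
        p \<cdot>\<^bsub>K\<^esub> j = zero_ar K B A \<and> q \<cdot>\<^bsub>K\<^esub> i = zero_ar K A B \<and>
        (i \<cdot>\<^bsub>K\<^esub> p) \<boxplus>\<^bsub>K\<^esub> (j \<cdot>\<^bsub>K\<^esub> q) = ide K S)"

definition direct_summand :: "('o, 'm, 'z) additive_data_scheme \<Rightarrow> 'o \<Rightarrow> 'o \<Rightarrow> bool" where
  "direct_summand K A S \<longleftrightarrow> (\<exists>B. biproduct K A B S)"

locale additive_category = category K
  for K :: "('o, 'm, 'z) additive_data_scheme" (structure) +
  assumes hom_comm_group: "A \<in> ob K \<Longrightarrow> B \<in> ob K \<Longrightarrow> comm_group (hom_group K A B)"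
    and cmp_add_left: "f \<in> Hom K A B \<Longrightarrow> g \<in> Hom K B C \<Longrightarrow> g' \<in> Hom K B C
      \<Longrightarrow> (g \<boxplus> g') \<cdot> f = (g \<cdot> f) \<boxplus> (g' \<cdot> f)"
    and cmp_add_right: "f \<in> Hom K A B \<Longrightarrow> f' \<in> Hom K A B \<Longrightarrow> g \<in> Hom K B C
      \<Longrightarrow> g \<cdot> (f \<boxplus> f') = (g \<cdot> f) \<boxplus> (g \<cdot> f')"
    and ex_zero_object: "\<exists>Z. zero_object K Z"
    and ex_biproduct: "A \<in> ob K \<Longrightarrow> B \<in> ob K \<Longrightarrow> \<exists>S. biproduct K A B S"

definition additive_endofunctor ::
  "('o, 'm, 'z) additive_data_scheme \<Rightarrow> ('o \<Rightarrow> 'o) \<Rightarrow> ('m \<Rightarrow> 'm) \<Rightarrow> bool" where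
  "additive_endofunctor K Fo Fa \<longleftrightarrow>
     endofunctor K Fo Fa \<and>
     (\<forall>A B. \<forall>f \<in> Hom K A B. \<forall>g \<in> Hom K A B. Fa (f \<boxplus>\<^bsub>K\<^esub> g) = Fa f \<boxplus>\<^bsub>K\<^esub> Fa g)"


section \<open>Triangulated categories\<close>

text \<open>A triangle \<open>X \<rightarrow> Y \<rightarrow> Z \<rightarrow> \<Sigma>X\<close> is given by the triple of its arrows. The shift on objects is
  \<open>shift\<close>, on arrows \<open>shift_ar\<close>; it is only required to be an equivalence.\<close>

record ('o, 'm) triangulated_data = "('o, 'm) additive_data" +
  shift :: "'o \<Rightarrow> 'o"
  shift_ar :: "'m \<Rightarrow> 'm"
  dist :: "('m \<times> 'm \<times> 'm) set"

definition triangle :: "('o, 'm, 'z) triangulated_data_scheme \<Rightarrow> 'm \<Rightarrow> 'm \<Rightarrow> 'm \<Rightarrow> bool" where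
  "triangle K f g h \<longleftrightarrow>
     f \<in> ar K \<and> g \<in> ar K \<and> h \<in> ar K \<and>
     tgt K f = src K g \<and> tgt K g = src K h \<and> tgt K h = shift K (src K f)"

locale triangulated_category = additive_category K
  for K :: "('o, 'm, 'z) triangulated_data_scheme" (structure) +
  assumes shift_additive: "additive_endofunctor K (shift K) (shift_ar K)"
    and shift_fully_faithful: "A \<in> ob K \<Longrightarrow> B \<in> ob K
      \<Longrightarrow> bij_betw (shift_ar K) (Hom K A B) (Hom K (shift K A) (shift K B))"
    and shift_ess_surj: "B \<in> ob K \<Longrightarrow> \<exists>A \<in> ob K. isomorphic K (shift K A) B"
    and dist_triangle: "(f, g, h) \<in> dist K \<Longrightarrow> triangle K f g h"
    and dist_iso_closed: "(f, g, h) \<in> dist K \<Longrightarrow> triangle K f' g' h'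
      \<Longrightarrow> a \<in> Hom K (src K f) (src K f') \<Longrightarrow> is_iso K a
      \<Longrightarrow> b \<in> Hom K (src K g) (src K g') \<Longrightarrow> is_iso K b
      \<Longrightarrow> c \<in> Hom K (src K h) (src K h') \<Longrightarrow> is_iso K c
      \<Longrightarrow> b \<cdot> f = f' \<cdot> a \<Longrightarrow> c \<cdot> g = g' \<cdot> b \<Longrightarrow> shift_ar K a \<cdot> h = h' \<cdot> c
      \<Longrightarrow> (f', g', h') \<in> dist K"
    and dist_ide: "A \<in> ob K \<Longrightarrow> zero_object K Z
      \<Longrightarrow> (ide K A, zero_ar K A Z, zero_ar K Z (shift K A)) \<in> dist K"
    and dist_ex: "f \<in> ar K \<Longrightarrow> \<exists>g h. (f, g, h) \<in> dist K"
    and dist_rotate: "triangle K f g h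
      \<Longrightarrow> (f, g, h) \<in> dist K \<longleftrightarrow> (g, h, neg_ar K (shift_ar K f)) \<in> dist K"
    and dist_morphism: "(f, g, h) \<in> dist K \<Longrightarrow> (f', g', h') \<in> dist K
      \<Longrightarrow> a \<in> Hom K (src K f) (src K f') \<Longrightarrow> b \<in> Hom K (src K g) (src K g')
      \<Longrightarrow> b \<cdot> f = f' \<cdot> a
      \<Longrightarrow> \<exists>c \<in> Hom K (src K h) (src K h'). c \<cdot> g = g' \<cdot> b \<and> shift_ar K a \<cdot> h = h' \<cdot> c"
    and octahedral: "f \<in> Hom K X Y \<Longrightarrow> g \<in> Hom K Y Z
      \<Longrightarrow> (f, u, u') \<in> dist K \<Longrightarrow> (g, v, v') \<in> dist K \<Longrightarrow> (g \<cdot> f, w, w') \<in> dist K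
      \<Longrightarrow> \<exists>p q. (p, q, shift_ar K u \<cdot> v') \<in> dist K \<and>
            p \<in> Hom K (tgt K u) (tgt K w) \<and> q \<in> Hom K (tgt K w) (tgt K v) \<and>
            p \<cdot> u = w \<cdot> g \<and> w' \<cdot> p = u' \<and> q \<cdot> w = v \<and> v' \<cdot> q = shift_ar K f \<cdot> w'"

definition exact_endofunctor ::
  "('o, 'm, 'z) triangulated_data_scheme \<Rightarrow> ('o \<Rightarrow> 'o) \<Rightarrow> ('m \<Rightarrow> 'm) \<Rightarrow> bool" where
  "exact_endofunctor K Fo Fa \<longleftrightarrow>
     additive_endofunctor K Fo Fa \<and>
     (\<exists>\<theta>. natural_iso K (Fo \<circ> shift K) (Fa \<circ> shift_ar K) (shift K \<circ> Fo) (shift_ar K \<circ> Fa) \<theta> \<and>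
        (\<forall>f g h. (f, g, h) \<in> dist K \<longrightarrow> (Fa f, Fa g, \<theta> (src K f) \<cdot>\<^bsub>K\<^esub> Fa h) \<in> dist K))"


section \<open>Tensor triangulated categories\<close>

record ('o, 'm) tensor_triangulated_data = "('o, 'm) triangulated_data" +
  tensor :: "'o \<Rightarrow> 'o \<Rightarrow> 'o" (infixr "\<boxtimes>\<index>" 75)
  tensor_ar :: "'m \<Rightarrow> 'm \<Rightarrow> 'm" (infixr "\<boxdot>\<index>" 75)
  unit :: "'o" ("\<I>\<index>")
  assoc :: "'o \<Rightarrow> 'o \<Rightarrow> 'o \<Rightarrow> 'm"
  lunit :: "'o \<Rightarrow> 'm"
  runit :: "'o \<Rightarrow> 'm"
  braid :: "'o \<Rightarrow> 'o \<Rightarrow> 'm"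

locale tensor_triangulated_category = triangulated_category K
  for K :: "('o, 'm, 'z) tensor_triangulated_data_scheme" (structure) +
  assumes unit_ob: "\<I> \<in> ob K"
    and tensor_ob: "A \<in> ob K \<Longrightarrow> B \<in> ob K \<Longrightarrow> A \<boxtimes> B \<in> ob K"
    and tensor_Hom: "f \<in> Hom K A B \<Longrightarrow> g \<in> Hom K C D \<Longrightarrow> f \<boxdot> g \<in> Hom K (A \<boxtimes> C) (B \<boxtimes> D)"
    and tensor_ide: "A \<in> ob K \<Longrightarrow> B \<in> ob K \<Longrightarrow> ide K A \<boxdot> ide K B = ide K (A \<boxtimes> B)"
    and tensor_cmp: "f \<in> Hom K A B \<Longrightarrow> f' \<in> Hom K B C \<Longrightarrow> g \<in> Hom K A' B' \<Longrightarrow> g' \<in> Hom K B' C'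
      \<Longrightarrow> (f' \<cdot> f) \<boxdot> (g' \<cdot> g) = (f' \<boxdot> g') \<cdot> (f \<boxdot> g)"
    and assoc_Hom: "A \<in> ob K \<Longrightarrow> B \<in> ob K \<Longrightarrow> C \<in> ob K
      \<Longrightarrow> assoc K A B C \<in> Hom K ((A \<boxtimes> B) \<boxtimes> C) (A \<boxtimes> (B \<boxtimes> C))"
    and assoc_iso: "A \<in> ob K \<Longrightarrow> B \<in> ob K \<Longrightarrow> C \<in> ob K \<Longrightarrow> is_iso K (assoc K A B C)"
    and assoc_natural: "f \<in> Hom K A A' \<Longrightarrow> g \<in> Hom K B B' \<Longrightarrow> h \<in> Hom K C C'
      \<Longrightarrow> assoc K A' B' C' \<cdot> ((f \<boxdot> g) \<boxdot> h) = (f \<boxdot> (g \<boxdot> h)) \<cdot> assoc K A B C"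
    and lunit_natural_iso: "natural_iso K (\<lambda>A. \<I> \<boxtimes> A) (\<lambda>f. ide K \<I> \<boxdot> f) (\<lambda>A. A) (\<lambda>f. f) (lunit K)"
    and runit_natural_iso: "natural_iso K (\<lambda>A. A \<boxtimes> \<I>) (\<lambda>f. f \<boxdot> ide K \<I>) (\<lambda>A. A) (\<lambda>f. f) (runit K)"
    and pentagon: "A \<in> ob K \<Longrightarrow> B \<in> ob K \<Longrightarrow> C \<in> ob K \<Longrightarrow> D \<in> ob K
      \<Longrightarrow> assoc K A B (C \<boxtimes> D) \<cdot> assoc K (A \<boxtimes> B) C D =
          (ide K A \<boxdot> assoc K B C D) \<cdot> assoc K A (B \<boxtimes> C) D \<cdot> (assoc K A B C \<boxdot> ide K D)"
    and unit_triangle: "A \<in> ob K \<Longrightarrow> B \<in> ob K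
      \<Longrightarrow> (ide K A \<boxdot> lunit K B) \<cdot> assoc K A \<I> B = runit K A \<boxdot> ide K B"
    and braid_Hom: "A \<in> ob K \<Longrightarrow> B \<in> ob K \<Longrightarrow> braid K A B \<in> Hom K (A \<boxtimes> B) (B \<boxtimes> A)"
    and braid_iso: "A \<in> ob K \<Longrightarrow> B \<in> ob K \<Longrightarrow> is_iso K (braid K A B)"
    and braid_natural: "f \<in> Hom K A A' \<Longrightarrow> g \<in> Hom K B B'
      \<Longrightarrow> braid K A' B' \<cdot> (f \<boxdot> g) = (g \<boxdot> f) \<cdot> braid K A B"
    and hexagon1: "A \<in> ob K \<Longrightarrow> B \<in> ob K \<Longrightarrow> C \<in> ob K
      \<Longrightarrow> assoc K B C A \<cdot> braid K A (B \<boxtimes> C) \<cdot> assoc K A B C =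
          (ide K B \<boxdot> braid K A C) \<cdot> assoc K B A C \<cdot> (braid K A B \<boxdot> ide K C)"
    and hexagon2: "A \<in> ob K \<Longrightarrow> B \<in> ob K \<Longrightarrow> C \<in> ob K
      \<Longrightarrow> inv_ar K (assoc K C A B) \<cdot> braid K (A \<boxtimes> B) C \<cdot> inv_ar K (assoc K A B C) =
          (braid K A C \<boxdot> ide K B) \<cdot> inv_ar K (assoc K A C B) \<cdot> (ide K A \<boxdot> braid K B C)"
    and tensor_exact_right: "A \<in> ob K \<Longrightarrow> exact_endofunctor K (\<lambda>X. A \<boxtimes> X) (\<lambda>f. ide K A \<boxdot> f)"
    and tensor_exact_left: "A \<in> ob K \<Longrightarrow> exact_endofunctor K (\<lambda>X. X \<boxtimes> A) (\<lambda>f. f \<boxdot> ide K A)"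

text \<open>Rigidity (strong dualizability): existence of a dual \<open>D\<close> with evaluation \<open>ev\<close> and
  coevaluation \<open>cv\<close> satisfying the two triangle identities, written with associators and unitors.\<close>

definition rigid :: "('o, 'm, 'z) tensor_triangulated_data_scheme \<Rightarrow> 'o \<Rightarrow> bool" where
  "rigid K A \<longleftrightarrow>
     (\<exists>D \<in> ob K. \<exists>ev \<in> Hom K (D \<boxtimes>\<^bsub>K\<^esub> A) \<I>\<^bsub>K\<^esub>. \<exists>cv \<in> Hom K \<I>\<^bsub>K\<^esub> (A \<boxtimes>\<^bsub>K\<^esub> D).
        runit K A \<cdot>\<^bsub>K\<^esub> (ide K A \<boxdot>\<^bsub>K\<^esub> ev) \<cdot>\<^bsub>K\<^esub> assoc K A D A \<cdot>\<^bsub>K\<^esub> (cv \<boxdot>\<^bsub>K\<^esub> ide K A) = lunit K A \<and>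
        lunit K D \<cdot>\<^bsub>K\<^esub> (ev \<boxdot>\<^bsub>K\<^esub> ide K D) \<cdot>\<^bsub>K\<^esub> inv_ar K (assoc K D A D) \<cdot>\<^bsub>K\<^esub> (ide K D \<boxdot>\<^bsub>K\<^esub> cv) = runit K D)"


section \<open>Compactly generated tensor triangulated categories\<close>

text \<open>Set-indexed coproducts need a notion of size: a category whose coproducts are indexed by
  arbitrary HOL sets over its own types would degenerate. The infinite set \<open>U\<close> plays the role of
  a universe, and the small index sets are, up to bijection, the subsets of \<open>U\<close> of strictly smaller
  cardinality. For \<open>|U|\<close> strongly inaccessible these are the sets of a Grothendieck universe; only
  uncountability and regularity are imposed.\<close>

definition universe :: "'u set \<Rightarrow> bool" where
  "universe U \<longleftrightarrow> uncountable U \<and> regularCard |U|"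

definition small :: "'u set \<Rightarrow> 'u set \<Rightarrow> bool" where
  "small U I \<longleftrightarrow> I \<subseteq> U \<and> |I| <o |U|"

text \<open>\<open>C\<close> is compact if for every small coproduct \<open>S\<close> of a family \<open>X\<close> the canonical map from
  the direct sum of the \<open>Hom(C, X i)\<close> to \<open>Hom(C, S)\<close> is an isomorphism of groups. Since
  \<^const>\<open>hom_group\<close> is written multiplicatively, \<^const>\<open>gfinprod\<close> is the finite sum of arrows.\<close>

definition compact_objects ::
  "('o, 'm, 'z) additive_data_scheme \<Rightarrow> 'u set \<Rightarrow> 'o set" where
  "compact_objects K U =
     {C \<in> ob K. \<forall>I X S \<iota>. small U I \<longrightarrow> coproduct K I X S \<iota> \<longrightarrow>
        (\<lambda>h. gfinprod (hom_group K C S) (\<lambda>i. \<iota> i \<cdot>\<^bsub>K\<^esub> h i) I)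
          \<in> iso (sum_group I (\<lambda>i. hom_group K C (X i))) (hom_group K C S)}"

locale compactly_generated_ttc = tensor_triangulated_category K
  for K :: "('o, 'm, 'z) tensor_triangulated_data_scheme" (structure) +
  fixes U :: "'u set"
  assumes universe: "universe U"
    and ex_coproduct: "small U I \<Longrightarrow> (\<And>i. i \<in> I \<Longrightarrow> X i \<in> ob K) \<Longrightarrow> \<exists>S \<iota>. coproduct K I X S \<iota>"
    and tensor_coproduct_right: "small U I \<Longrightarrow> coproduct K I X S \<iota> \<Longrightarrow> A \<in> ob K
      \<Longrightarrow> coproduct K I (\<lambda>i. A \<boxtimes> X i) (A \<boxtimes> S) (\<lambda>i. ide K A \<boxdot> \<iota> i)"
    and tensor_coproduct_left: "small U I \<Longrightarrow> coproduct K I X S \<iota> \<Longrightarrow> A \<in> ob K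
      \<Longrightarrow> coproduct K I (\<lambda>i. X i \<boxtimes> A) (S \<boxtimes> A) (\<lambda>i. \<iota> i \<boxdot> ide K A)"
    and compactly_generated: "\<exists>G \<subseteq> compact_objects K U. |G| <o |U| \<and>
      (\<forall>M \<in> ob K. (\<forall>C \<in> G. \<forall>f \<in> Hom K C M. f = zero_ar K C M) \<longrightarrow> zero_object K M)"
    and compact_tensor: "A \<in> compact_objects K U \<Longrightarrow> B \<in> compact_objects K U
      \<Longrightarrow> A \<boxtimes> B \<in> compact_objects K U"
    and compact_unit: "\<I> \<in> compact_objects K U"
    and compact_rigid: "A \<in> compact_objects K U \<Longrightarrow> rigid K A"


section \<open>Thick tensor ideals of the compact part\<close>

text \<open>Full subcategories are represented by their sets of objects. The distinguished triangles of
  the compact part are the distinguished triangles of the ambient category with compact vertices.\<close>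

definition compact_triangle ::
  "('o, 'm, 'z) triangulated_data_scheme \<Rightarrow> 'u set \<Rightarrow> 'o \<Rightarrow> 'o \<Rightarrow> 'o \<Rightarrow> bool" where
  "compact_triangle K U A B C \<longleftrightarrow>
     A \<in> compact_objects K U \<and> B \<in> compact_objects K U \<and> C \<in> compact_objects K U \<and>
     (\<exists>f g h. (f, g, h) \<in> dist K \<and> src K f = A \<and> src K g = B \<and> src K h = C)"

definition triangulated_subcategory ::
  "('o, 'm, 'z) triangulated_data_scheme \<Rightarrow> 'u set \<Rightarrow> 'o set \<Rightarrow> bool" where
  "triangulated_subcategory K U S \<longleftrightarrow>
     S \<subseteq> compact_objects K U \<and>
     (\<forall>Z. zero_object K Z \<longrightarrow> Z \<in> S) \<and>
     (\<forall>A \<in> S. \<forall>B. isomorphic K A B \<longrightarrow> B \<in> S) \<and>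
     (\<forall>A \<in> compact_objects K U. shift K A \<in> S \<longleftrightarrow> A \<in> S) \<and>
     (\<forall>A B C. compact_triangle K U A B C \<longrightarrow>
        (A \<in> S \<and> B \<in> S \<longrightarrow> C \<in> S) \<and> (B \<in> S \<and> C \<in> S \<longrightarrow> A \<in> S) \<and> (A \<in> S \<and> C \<in> S \<longrightarrow> B \<in> S))"

definition tensor_ideal ::
  "('o, 'm, 'z) tensor_triangulated_data_scheme \<Rightarrow> 'u set \<Rightarrow> 'o set \<Rightarrow> bool" where
  "tensor_ideal K U S \<longleftrightarrow>
     triangulated_subcategory K U S \<and>
     (\<forall>A \<in> S. \<forall>B \<in> compact_objects K U. A \<boxtimes>\<^bsub>K\<^esub> B \<in> S \<and> B \<boxtimes>\<^bsub>K\<^esub> A \<in> S)"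

definition thick_tensor_ideal ::
  "('o, 'm, 'z) tensor_triangulated_data_scheme \<Rightarrow> 'u set \<Rightarrow> 'o set \<Rightarrow> bool" where
  "thick_tensor_ideal K U S \<longleftrightarrow>
     tensor_ideal K U S \<and>
     (\<forall>B \<in> S. \<forall>A \<in> compact_objects K U. direct_summand K A B \<longrightarrow> A \<in> S)"

definition Tensor ::
  "('o, 'm, 'z) tensor_triangulated_data_scheme \<Rightarrow> 'u set \<Rightarrow> 'o \<Rightarrow> 'o set" where
  "Tensor K U M = {Q \<in> compact_objects K U. \<forall>S. thick_tensor_ideal K U S \<and> M \<in> S \<longrightarrow> Q \<in> S}"


section \<open>Zariski spaces and quasi support data\<close>

definition noetherian_space :: "'x topology \<Rightarrow> bool" where
  "noetherian_space X \<longleftrightarrow>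
     (\<forall>C :: nat \<Rightarrow> 'x set. (\<forall>n. closedin X (C n) \<and> C (Suc n) \<subseteq> C n)
        \<longrightarrow> (\<exists>m. \<forall>n \<ge> m. C n = C m))"

definition irreducible_closed :: "'x topology \<Rightarrow> 'x set \<Rightarrow> bool" where
  "irreducible_closed X C \<longleftrightarrow>
     closedin X C \<and> C \<noteq> {} \<and>
     (\<forall>D E. closedin X D \<longrightarrow> closedin X E \<longrightarrow> C = D \<union> E \<longrightarrow> C = D \<or> C = E)"

definition zariski_space :: "'x topology \<Rightarrow> bool" where
  "zariski_space X \<longleftrightarrow>
     noetherian_space X \<and>
     (\<forall>C. irreducible_closed X C \<longrightarrow> (\<exists>!x. x \<in> topspace X \<and> X closure_of {x} = C))"

locale quasi_support_data =
  fixes K :: "('o, 'm, 'z) tensor_triangulated_data_scheme" (structure)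
    and U :: "'u set" and X :: "'x topology" and V :: "'o \<Rightarrow> 'x set"
  assumes closed: "M \<in> compact_objects K U \<Longrightarrow> closedin X (V M)"
    and zero: "zero_object K Z \<Longrightarrow> V Z = {}"
    and unit: "V \<I> = topspace X"
    and coproduct: "small U I \<Longrightarrow> coproduct K I F S \<iota> \<Longrightarrow> (\<And>i. i \<in> I \<Longrightarrow> F i \<in> compact_objects K U)
      \<Longrightarrow> S \<in> compact_objects K U \<Longrightarrow> V S = (\<Union>i \<in> I. V (F i))"
    and shift: "M \<in> compact_objects K U \<Longrightarrow> V (shift K M) = V M"
    and triangle: "compact_triangle K U M N Q \<Longrightarrow> V N \<subseteq> V M \<union> V Q"
    and tensor: "M \<in> compact_objects K U \<Longrightarrow> N \<in> compact_objects K U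
      \<Longrightarrow> V (M \<boxtimes> N) \<subseteq> V M \<inter> V N"

definition support_ideal ::
  "('o, 'm, 'z) tensor_triangulated_data_scheme \<Rightarrow> 'u set \<Rightarrow> ('o \<Rightarrow> 'x set) \<Rightarrow> 'x set \<Rightarrow> 'o set" where
  "support_ideal K U V W = {Q \<in> compact_objects K U. V Q \<subseteq> W}"

end

theory Submission
  imports Defs
begin

text \<open>Only \<open>V(M) \<inter> V(N) \<subseteq> V(M \<otimes> N)\<close> has to be shown. The left hand side is closed, so it is \<open>V(L)\<close> for
  some compact \<open>L\<close>. By the classification of the ideals \<open>I\<^bsub>V(-)\<^esub>\<close> as principal thick tensor ideals, the
  choice of \<open>L\<close> means that \<open>L\<close> lies in \<open>Tensor(M)\<close> and in \<open>Tensor(N)\<close>, and the claim says that it lies in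
  \<open>Tensor(M \<otimes> N)\<close>. The argument is the one for radical ideals of a commutative ring: ideal quotients give
  \<open>L \<otimes> L \<in> Tensor(M \<otimes> N)\<close> (\<open>thick_quotient\<close>), and all thick tensor ideals are radical, because a
  rigid object \<open>L\<close> is a retract of \<open>L \<otimes> L\<^sup>* \<otimes> L\<close> (\<open>thick_radical\<close>).

  Two points need work. A tensor ideal absorbs only compact objects, so the dual \<open>L\<^sup>*\<close>, a
  priori just some object of the category, must be shown compact; likewise quotient ideals are
  triangulated only if the compact objects are closed under isomorphism and shift. All three follow
  from one principle: \<open>C\<close> is compact when \<open>Hom(C, -)\<close> is a retract of \<open>Hom(C', F -)\<close> with \<open>C'\<close> compact and \<open>F\<close>
  compatible with coproducts (\<open>compact_retract\<close>). Moreover thick subcategories are closed under direct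
  summands by definition, hence under retracts because sections split off a complement in a
  triangulated category (\<open>split_mono_direct_summand\<close>).\<close>

section \<open>Arrows in additive categories\<close>

lemma hom_group_simps [simp]:
  "carrier (hom_group K A B) = Hom K A B"
  "monoid.mult (hom_group K A B) = add_ar K"
  "one (hom_group K A B) = zero_ar K A B"
  by (simp_all add: hom_group_def)

context category
begin

lemma ide_arrow:
  "A \<in> ob K \<Longrightarrow> ide K A \<in> ar K" "A \<in> ob K \<Longrightarrow> src K (ide K A) = A" "A \<in> ob K \<Longrightarrow> tgt K (ide K A) = A"
  using ide_Hom by (auto simp: Hom_def)

text \<open>Typing facts in terms of sources and targets, unlike those in terms of \<^const>\<open>Hom\<close>, leave no
  variable of a premise undetermined, so the simplifier can use them as conditional rewrite rules.\<close>

lemma cmp_arrow: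
  assumes "f \<in> ar K" "g \<in> ar K" "tgt K f = src K g"
  shows "g \<cdot> f \<in> ar K" "src K (g \<cdot> f) = src K f" "tgt K (g \<cdot> f) = tgt K g"
  using cmp_Hom[of f "src K f" "tgt K f" g "tgt K g"] assms by (auto simp: Hom_def)

lemma cmp_assoc_arrow:
  "f \<in> ar K \<Longrightarrow> g \<in> ar K \<Longrightarrow> h \<in> ar K \<Longrightarrow> tgt K f = src K g \<Longrightarrow> tgt K g = src K h
    \<Longrightarrow> (h \<cdot> g) \<cdot> f = h \<cdot> (g \<cdot> f)"
  using cmp_assoc[of f "src K f" "tgt K f" g "tgt K g" h "tgt K h"] by (auto simp: Hom_def)

lemma cmp_ide_arrow:
  "f \<in> ar K \<Longrightarrow> src K f = A \<Longrightarrow> f \<cdot> ide K A = f"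
  "f \<in> ar K \<Longrightarrow> tgt K f = A \<Longrightarrow> ide K A \<cdot> f = f"
  using cmp_ide_right[of f "src K f" "tgt K f"] cmp_ide_left[of f "src K f" "tgt K f"]
  by (auto simp: Hom_def)

lemmas arrow_simps =
  src_ob tgt_ob ide_arrow cmp_arrow cmp_assoc_arrow cmp_ide_arrow

lemma Hom_ob: "f \<in> Hom K A B \<Longrightarrow> A \<in> ob K" "f \<in> Hom K A B \<Longrightarrow> B \<in> ob K"
  using src_ob tgt_ob by (auto simp: Hom_def)

lemma inverse_arrows_unique:
  assumes "inverse_arrows K f g" "inverse_arrows K f g'"
  shows "g = g'"
proof -
  have "g = g \<cdot> (f \<cdot> g')"
    using assms by (simp add: inverse_arrows_def Hom_def arrow_simps)
  also have "\<dots> = (g \<cdot> f) \<cdot> g'"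
    by (rule cmp_assoc_arrow[symmetric]) (use assms in \<open>auto simp: inverse_arrows_def Hom_def\<close>)
  also have "\<dots> = g'"
    using assms by (simp add: inverse_arrows_def Hom_def arrow_simps)
  finally show ?thesis .
qed

lemma inverse_arrows_inv_ar: "is_iso K f \<Longrightarrow> inverse_arrows K f (inv_ar K f)"
  unfolding is_iso_def inv_ar_def
  by (metis (no_types, lifting) inverse_arrows_unique theI)

lemma inv_ar_Hom:
  assumes "is_iso K f" "f \<in> Hom K A B"
  shows "inv_ar K f \<in> Hom K B A" "inv_ar K f \<cdot> f = ide K A" "f \<cdot> inv_ar K f = ide K B"
  using inverse_arrows_inv_ar[OF assms(1)] assms(2) by (auto simp: inverse_arrows_def Hom_def)

lemma is_isoE:
  assumes "is_iso K f" "f \<in> Hom K A B"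
  obtains g where "g \<in> Hom K B A" "g \<cdot> f = ide K A" "f \<cdot> g = ide K B"
  using assms that by (auto simp: is_iso_def inverse_arrows_def Hom_def)

lemma is_isoI:
  "f \<in> Hom K A B \<Longrightarrow> g \<in> Hom K B A \<Longrightarrow> g \<cdot> f = ide K A \<Longrightarrow> f \<cdot> g = ide K B \<Longrightarrow> is_iso K f"
  by (auto simp: is_iso_def inverse_arrows_def Hom_def)

lemma isomorphicI: "f \<in> Hom K A B \<Longrightarrow> is_iso K f \<Longrightarrow> isomorphic K A B"
  by (auto simp: isomorphic_def)

lemma isomorphic_sym: "isomorphic K A B \<Longrightarrow> isomorphic K B A"
  unfolding isomorphic_def by (metis is_isoE is_isoI)

lemma endofunctor_isomorphic:
  assumes F: "endofunctor K Fo Fa" and "isomorphic K A B"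
  shows "isomorphic K (Fo A) (Fo B)"
proof -
  obtain f where f: "f \<in> Hom K A B" "is_iso K f" using assms by (auto simp: isomorphic_def)
  then obtain g where g: "g \<in> Hom K B A" "g \<cdot> f = ide K A" "f \<cdot> g = ide K B" by (auto elim: is_isoE)
  have "is_iso K (Fa f)"
  proof (rule is_isoI)
    show "Fa f \<in> Hom K (Fo A) (Fo B)" "Fa g \<in> Hom K (Fo B) (Fo A)"
      using F f g by (auto simp: endofunctor_def)
    show "Fa g \<cdot> Fa f = ide K (Fo A)" "Fa f \<cdot> Fa g = ide K (Fo B)"
      using F f g Hom_ob[OF f(1)] unfolding endofunctor_def by metis+
  qed
  then show ?thesis using F f by (auto simp: endofunctor_def isomorphic_def)
qed

end

context additive_category
begin

lemma comm_group_hom_group [simp]: "A \<in> ob K \<Longrightarrow> B \<in> ob K \<Longrightarrow> comm_group (hom_group K A B)"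
  by (rule hom_comm_group)

lemma group_hom_group [simp]: "A \<in> ob K \<Longrightarrow> B \<in> ob K \<Longrightarrow> group (hom_group K A B)"
  using hom_comm_group comm_group.axioms(2) by blast

lemma zero_ar_Hom: "A \<in> ob K \<Longrightarrow> B \<in> ob K \<Longrightarrow> zero_ar K A B \<in> Hom K A B"
  using group.is_monoid[OF group_hom_group, THEN monoid.one_closed] by simp

lemma add_ar_Hom: "f \<in> Hom K A B \<Longrightarrow> g \<in> Hom K A B \<Longrightarrow> f \<boxplus> g \<in> Hom K A B"
  using group.is_monoid[OF group_hom_group, THEN monoid.m_closed, of A B f g] Hom_ob[of f A B] by simp

lemma postcompose_hom:
  assumes "A \<in> ob K" "g \<in> Hom K B C"
  shows "(\<lambda>f. g \<cdot> f) \<in> hom (hom_group K A B) (hom_group K A C)"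
  by (rule homI) (use assms in \<open>auto intro: cmp_Hom cmp_add_right\<close>)

lemma precompose_hom:
  assumes "C \<in> ob K" "f \<in> Hom K A B"
  shows "(\<lambda>g. g \<cdot> f) \<in> hom (hom_group K B C) (hom_group K A C)"
  by (rule homI) (use assms in \<open>auto intro: cmp_Hom cmp_add_left\<close>)

lemma cmp_zero_right: "A \<in> ob K \<Longrightarrow> g \<in> Hom K B C \<Longrightarrow> g \<cdot> zero_ar K A B = zero_ar K A C"
  using hom_one[OF postcompose_hom, of A g B C] Hom_ob[of g B C] by simp

lemma cmp_zero_left: "C \<in> ob K \<Longrightarrow> f \<in> Hom K A B \<Longrightarrow> zero_ar K B C \<cdot> f = zero_ar K A C"
  using hom_one[OF precompose_hom, of C f A B] Hom_ob[of f A B] by simp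

text \<open>In place of computations with negatives, differences are obtained from this lemma and compared by
  the cancellation law \<open>add_ar_eq_self\<close>.\<close>

lemma ex_difference:
  assumes "f \<in> Hom K A B" "g \<in> Hom K A B"
  obtains d where "d \<in> Hom K A B" "f \<boxplus> d = g"
proof -
  interpret G: comm_group "hom_group K A B" using Hom_ob[OF assms(1)] by simp
  let ?d = "inv\<^bsub>hom_group K A B\<^esub> f \<otimes>\<^bsub>hom_group K A B\<^esub> g"
  have "f \<otimes>\<^bsub>hom_group K A B\<^esub> ?d = g" "?d \<in> carrier (hom_group K A B)"
    using assms G.inv_closed[of f] G.m_assoc[of f "inv\<^bsub>hom_group K A B\<^esub> f" g] G.r_inv[of f] G.l_one[of g]
      G.m_closed[of "inv\<^bsub>hom_group K A B\<^esub> f" g] by auto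
  then show ?thesis using that by simp
qed

lemma add_ar_zero: "f \<in> Hom K A B \<Longrightarrow> f \<boxplus> zero_ar K A B = f" "f \<in> Hom K A B \<Longrightarrow> zero_ar K A B \<boxplus> f = f"
  using group.is_monoid[OF group_hom_group[of A B], THEN monoid.r_one, of f]
    group.is_monoid[OF group_hom_group[of A B], THEN monoid.l_one, of f] Hom_ob[of f A B] by auto

lemma add_ar_eq_self:
  assumes "f \<in> Hom K A B" "d \<in> Hom K A B" "f \<boxplus> d = f"
  shows "d = zero_ar K A B"
proof -
  interpret G: comm_group "hom_group K A B" using Hom_ob[OF assms(1)] by simp
  show ?thesis using G.l_cancel_one[of f d] assms by simp
qed

lemma neg_ar_Hom: "f \<in> Hom K A B \<Longrightarrow> neg_ar K f \<in> Hom K A B"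
  using group.inv_closed[OF group_hom_group, of A B f] Hom_ob[of f A B]
  by (auto simp: neg_ar_def Hom_def)

lemma additive_endofunctor_hom:
  assumes "additive_endofunctor K Fo Fa" "A \<in> ob K" "B \<in> ob K"
  shows "Fa \<in> hom (hom_group K A B) (hom_group K (Fo A) (Fo B))"
  by (rule homI) (use assms in \<open>auto simp: additive_endofunctor_def endofunctor_def\<close>)

lemma additive_endofunctor_zero:
  assumes "additive_endofunctor K Fo Fa" "A \<in> ob K" "B \<in> ob K"
  shows "Fa (zero_ar K A B) = zero_ar K (Fo A) (Fo B)"
  using hom_one[OF additive_endofunctor_hom[OF assms]] assms
  by (simp add: additive_endofunctor_def endofunctor_def)

lemma zero_object_iff: "zero_object K Z \<longleftrightarrow> Z \<in> ob K \<and> ide K Z = zero_ar K Z Z"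
proof
  show "Z \<in> ob K \<and> ide K Z = zero_ar K Z Z" if "zero_object K Z"
    using that ide_Hom zero_ar_Hom unfolding zero_object_def by metis
next
  assume Z: "Z \<in> ob K \<and> ide K Z = zero_ar K Z Z"
  show "zero_object K Z"
    unfolding zero_object_def
  proof (intro conjI ballI)
    fix A assume A: "A \<in> ob K"
    have "f = zero_ar K Z A" if "f \<in> Hom K Z A" for f
      using cmp_ide_right[OF that] cmp_zero_right[OF _ that] Z by metis
    then show "\<exists>!f. f \<in> Hom K Z A" using zero_ar_Hom[of Z A] Z A by blast
    have "f = zero_ar K A Z" if "f \<in> Hom K A Z" for f
      using cmp_ide_left[OF that] cmp_zero_left[OF _ that] Z by metis
    then show "\<exists>!f. f \<in> Hom K A Z" using zero_ar_Hom[of A Z] Z A by blast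
  qed (use Z in simp)
qed

lemma additive_endofunctor_zero_object:
  assumes "additive_endofunctor K Fo Fa" "zero_object K Z"
  shows "zero_object K (Fo Z)"
proof -
  have Z: "Z \<in> ob K" "ide K Z = zero_ar K Z Z" using assms by (auto simp: zero_object_iff)
  have "ide K (Fo Z) = Fa (ide K Z)" "Fo Z \<in> ob K"
    using assms Z(1) by (auto simp: additive_endofunctor_def endofunctor_def)
  then show ?thesis
    using additive_endofunctor_zero[OF assms(1) Z(1) Z(1)] Z(2) by (simp add: zero_object_iff)
qed

lemma additive_endofunctor_direct_summand:
  assumes F: "additive_endofunctor K Fo Fa" and "direct_summand K A S"
  shows "direct_summand K (Fo A) (Fo S)"
proof -
  have Fob: "\<And>A. A \<in> ob K \<Longrightarrow> Fo A \<in> ob K" and Fide: "\<And>A. A \<in> ob K \<Longrightarrow> Fa (ide K A) = ide K (Fo A)"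
    and FHom: "\<And>f A B. f \<in> Hom K A B \<Longrightarrow> Fa f \<in> Hom K (Fo A) (Fo B)"
    and Fcmp: "\<And>A B C f g. f \<in> Hom K A B \<Longrightarrow> g \<in> Hom K B C \<Longrightarrow> Fa (g \<cdot> f) = Fa g \<cdot> Fa f"
    and Fadd: "\<And>A B f g. f \<in> Hom K A B \<Longrightarrow> g \<in> Hom K A B \<Longrightarrow> Fa (f \<boxplus> g) = Fa f \<boxplus> Fa g"
    using F unfolding additive_endofunctor_def endofunctor_def by blast+
  obtain B i j p q where ob: "A \<in> ob K" "B \<in> ob K" "S \<in> ob K"
    and i: "i \<in> Hom K A S" and j: "j \<in> Hom K B S" and p: "p \<in> Hom K S A" and q: "q \<in> Hom K S B"
    and eq: "p \<cdot> i = ide K A" "q \<cdot> j = ide K B" "p \<cdot> j = zero_ar K B A" "q \<cdot> i = zero_ar K A B"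
      "(i \<cdot> p) \<boxplus> (j \<cdot> q) = ide K S"
    using assms unfolding direct_summand_def biproduct_def by blast
  have "biproduct K (Fo A) (Fo B) (Fo S)"
    unfolding biproduct_def
  proof (intro conjI bexI)
    show "(Fa i \<cdot> Fa p) \<boxplus> (Fa j \<cdot> Fa q) = ide K (Fo S)"
      using Fadd[OF cmp_Hom[OF p i] cmp_Hom[OF q j]] Fcmp[OF p i] Fcmp[OF q j] eq(5) Fide[OF ob(3)] by simp
    show "Fa p \<cdot> Fa i = ide K (Fo A)" using Fcmp[OF i p] eq Fide ob by simp
    show "Fa q \<cdot> Fa j = ide K (Fo B)" using Fcmp[OF j q] eq Fide ob by simp
    show "Fa p \<cdot> Fa j = zero_ar K (Fo B) (Fo A)"
      using Fcmp[OF j p] eq additive_endofunctor_zero[OF F] ob by simp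
    show "Fa q \<cdot> Fa i = zero_ar K (Fo A) (Fo B)"
      using Fcmp[OF i q] eq additive_endofunctor_zero[OF F] ob by simp
  qed (use FHom i j p q Fob ob in auto)
  then show ?thesis by (auto simp: direct_summand_def)
qed

end

section \<open>Retracts of compact objects\<close>

text \<open>The functor \<open>Hom(C, -)\<close> is a retract of \<open>Hom(C', -)\<close> as far as the coproduct \<open>S\<close> of the \<open>X i\<close> is
  concerned, where on the side of \<open>C'\<close> that coproduct may be replaced by another coproduct \<open>S'\<close> of
  objects \<open>X' i\<close>, such as its image under a functor preserving coproducts. The retractions are natural
  only with respect to the injections \<open>\<iota> i\<close> and \<open>\<iota>' i\<close>.\<close>

definition hom_retract ::
  "('o, 'm, 'z) additive_data_scheme \<Rightarrow> 'o \<Rightarrow> 'o \<Rightarrow> 'i set \<Rightarrow> ('i \<Rightarrow> 'o) \<Rightarrow> 'o \<Rightarrow> ('i \<Rightarrow> 'm) \<Rightarrow> bool" where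
  "hom_retract K C C' I X S \<iota> \<longleftrightarrow>
     (\<exists>X' S' \<iota>' \<phi> \<psi> a b. coproduct K I X' S' \<iota>' \<and>
        (\<forall>i\<in>I. \<phi> i \<in> hom (hom_group K C (X i)) (hom_group K C' (X' i)) \<and>
               \<psi> i \<in> hom (hom_group K C' (X' i)) (hom_group K C (X i)) \<and>
               (\<forall>h \<in> Hom K C (X i). \<psi> i (\<phi> i h) = h \<and> a (\<iota> i \<cdot>\<^bsub>K\<^esub> h) = \<iota>' i \<cdot>\<^bsub>K\<^esub> \<phi> i h) \<and>
               (\<forall>k \<in> Hom K C' (X' i). b (\<iota>' i \<cdot>\<^bsub>K\<^esub> k) = \<iota> i \<cdot>\<^bsub>K\<^esub> \<psi> i k)) \<and>
        a \<in> hom (hom_group K C S) (hom_group K C' S') \<and>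
        b \<in> hom (hom_group K C' S') (hom_group K C S) \<and>
        (\<forall>h \<in> Hom K C S. b (a h) = h))"

lemma gfinprod_hom:
  assumes "comm_group G" "comm_group H" "\<psi> \<in> hom G H" "f \<in> I \<rightarrow> carrier G"
    and fin: "finite {i \<in> I. f i \<noteq> \<one>\<^bsub>G\<^esub>}"
  shows "\<psi> (gfinprod G f I) = gfinprod H (\<lambda>i. \<psi> (f i)) I"
proof -
  interpret G: comm_group G by fact
  interpret H: comm_group H by fact
  let ?F = "{i \<in> I. f i \<noteq> \<one>\<^bsub>G\<^esub>}"
  have one: "\<psi> \<one>\<^bsub>G\<^esub> = \<one>\<^bsub>H\<^esub>" using assms(3) by (simp add: hom_one)
  have carr: "\<psi> x \<in> carrier H" if "x \<in> carrier G" for x using assms(3) that by (auto simp: hom_def)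
  have ind: "F \<subseteq> I \<Longrightarrow> \<psi> (finprod G f F) = finprod H (\<lambda>i. \<psi> (f i)) F" if "finite F" for F
    using that
  proof (induction F rule: finite_induct)
    case empty
    then show ?case by (simp add: one)
  next
    case (insert x F)
    have f: "f \<in> F \<rightarrow> carrier G" "f x \<in> carrier G" using insert assms(4) by auto
    then have g: "(\<lambda>i. \<psi> (f i)) \<in> F \<rightarrow> carrier H" "\<psi> (f x) \<in> carrier H" using carr by auto
    show ?case
      using insert f g by (simp add: hom_mult[OF assms(3)] G.finprod_closed)
  qed
  have "gfinprod H (\<lambda>i. \<psi> (f i)) I = gfinprod H (\<lambda>i. \<psi> (f i)) ?F"
    by (rule H.gfinprod_mono_neutral_cong_right) (use one carr assms(4) in auto)
  also have "\<dots> = finprod H (\<lambda>i. \<psi> (f i)) ?F"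
    by (rule H.gfinprod_eq_finprod) (use fin carr assms(4) in auto)
  also have "\<dots> = \<psi> (finprod G f ?F)" using ind[OF fin] by simp
  finally show ?thesis using fin by (simp add: gfinprod_def)
qed

lemma sum_group_map_carrier:
  assumes "\<And>i. i \<in> I \<Longrightarrow> group (G i)" "\<And>i. i \<in> I \<Longrightarrow> group (H i)"
    and "\<And>i. i \<in> I \<Longrightarrow> \<phi> i \<in> hom (G i) (H i)" and x: "x \<in> carrier (sum_group I G)"
  shows "(\<lambda>i\<in>I. \<phi> i (x i)) \<in> carrier (sum_group I H)"
proof -
  have "{i \<in> I. \<phi> i (x i) \<noteq> \<one>\<^bsub>H i\<^esub>} \<subseteq> {i \<in> I. x i \<noteq> \<one>\<^bsub>G i\<^esub>}"
    using assms(1-3) by (auto simp: hom_one)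
  moreover have "finite {i \<in> I. x i \<noteq> \<one>\<^bsub>G i\<^esub>}" using x assms(1) by (simp add: carrier_sum_group)
  ultimately have "finite {i \<in> I. \<phi> i (x i) \<noteq> \<one>\<^bsub>H i\<^esub>}" by (rule finite_subset)
  moreover have "\<phi> i (x i) \<in> carrier (H i)" if "i \<in> I" for i
    using assms x that by (fastforce simp: carrier_sum_group hom_def)
  ultimately show ?thesis
    using assms(2) by (auto simp: carrier_sum_group cong: conj_cong)
qed

text \<open>A homomorphism that is a retract of an isomorphism is bijective: injectivity is inherited
  through the section \<open>a\<close> and surjectivity through the retractions \<open>a'\<close>, \<open>b'\<close>.\<close>

lemma iso_retract:
  assumes u': "u' \<in> iso G' H'" and u: "u \<in> hom G H"
    and a: "\<And>x. x \<in> carrier G \<Longrightarrow> a x \<in> carrier G'"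
    and a': "\<And>x. x \<in> carrier G' \<Longrightarrow> a' x \<in> carrier G"
    and b: "\<And>y. y \<in> carrier H \<Longrightarrow> b y \<in> carrier H'"
    and aa: "\<And>x. x \<in> carrier G \<Longrightarrow> a' (a x) = x"
    and bb: "\<And>y. y \<in> carrier H \<Longrightarrow> b' (b y) = y"
    and ub: "\<And>x. x \<in> carrier G \<Longrightarrow> b (u x) = u' (a x)"
    and ub': "\<And>x. x \<in> carrier G' \<Longrightarrow> b' (u' x) = u (a' x)"
  shows "u \<in> iso G H"
proof -
  have bij: "bij_betw u' (carrier G') (carrier H')" using u' by (auto simp: iso_def)
  have "inj_on u (carrier G)"
  proof (rule inj_onI)
    fix x y assume xy: "x \<in> carrier G" "y \<in> carrier G" "u x = u y"
    then have "u' (a x) = u' (a y)" using ub by metis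
    then have "a x = a y" using bij a xy by (meson bij_betw_def inj_onD)
    then show "x = y" using aa xy by metis
  qed
  moreover have "y \<in> u ` carrier G" if y: "y \<in> carrier H" for y
  proof -
    obtain x where x: "x \<in> carrier G'" "u' x = b y" using bij b[OF y] by (metis bij_betw_def imageE)
    then have "u (a' x) = y" using ub'[OF x(1)] bb[OF y] by simp
    then show ?thesis using a'[OF x(1)] by blast
  qed
  moreover have "u ` carrier G \<subseteq> carrier H" using u by (auto simp: hom_def)
  ultimately show ?thesis using u by (auto simp: iso_def bij_betw_def)
qed

context additive_category
begin

text \<open>The canonical map \<open>\<Oplus> Hom(C, X i) \<rightarrow> Hom(C, S)\<close> is a retract of \<open>\<Oplus> Hom(C', X' i) \<rightarrow> Hom(C', S')\<close>, which
  is an isomorphism.\<close>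

lemma compact_retract:
  fixes U :: "'u set"
  assumes C: "C \<in> ob K" and C': "C' \<in> compact_objects K U"
    and retract: "\<And>I X S \<iota>. small U I \<Longrightarrow> coproduct K I X S \<iota> \<Longrightarrow> hom_retract K C C' I X S \<iota>"
  shows "C \<in> compact_objects K U"
  unfolding compact_objects_def
proof (intro CollectI conjI allI impI)
  show "C \<in> ob K" by fact
  fix I :: "'u set" and X S \<iota>
  assume I: "small U I" and cop: "coproduct K I X S \<iota>"
  obtain X' S' \<iota>' \<phi> \<psi> a b
    where R: "coproduct K I X' S' \<iota>' \<and>
        (\<forall>i\<in>I. \<phi> i \<in> hom (hom_group K C (X i)) (hom_group K C' (X' i)) \<and>
               \<psi> i \<in> hom (hom_group K C' (X' i)) (hom_group K C (X i)) \<and>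
               (\<forall>h \<in> Hom K C (X i). \<psi> i (\<phi> i h) = h \<and> a (\<iota> i \<cdot> h) = \<iota>' i \<cdot> \<phi> i h) \<and>
               (\<forall>k \<in> Hom K C' (X' i). b (\<iota>' i \<cdot> k) = \<iota> i \<cdot> \<psi> i k)) \<and>
        a \<in> hom (hom_group K C S) (hom_group K C' S') \<and>
        b \<in> hom (hom_group K C' S') (hom_group K C S) \<and>
        (\<forall>h \<in> Hom K C S. b (a h) = h)"
    using retract[OF I cop] unfolding hom_retract_def by (elim exE) (rule that)
  from R have cop': "coproduct K I X' S' \<iota>'"
    and \<phi>: "\<And>i. i \<in> I \<Longrightarrow> \<phi> i \<in> hom (hom_group K C (X i)) (hom_group K C' (X' i))"
    and \<psi>: "\<And>i. i \<in> I \<Longrightarrow> \<psi> i \<in> hom (hom_group K C' (X' i)) (hom_group K C (X i))"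
    and \<psi>\<phi>: "\<And>i h. i \<in> I \<Longrightarrow> h \<in> Hom K C (X i) \<Longrightarrow> \<psi> i (\<phi> i h) = h"
    and a\<phi>: "\<And>i h. i \<in> I \<Longrightarrow> h \<in> Hom K C (X i) \<Longrightarrow> a (\<iota> i \<cdot> h) = \<iota>' i \<cdot> \<phi> i h"
    and b\<psi>: "\<And>i k. i \<in> I \<Longrightarrow> k \<in> Hom K C' (X' i) \<Longrightarrow> b (\<iota>' i \<cdot> k) = \<iota> i \<cdot> \<psi> i k"
    and a: "a \<in> hom (hom_group K C S) (hom_group K C' S')"
    and b: "b \<in> hom (hom_group K C' S') (hom_group K C S)"
    and ba: "\<And>h. h \<in> Hom K C S \<Longrightarrow> b (a h) = h"
    by auto
  have C'ob: "C' \<in> ob K" using C' by (simp add: compact_objects_def)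
  have S: "S \<in> ob K" and S': "S' \<in> ob K" using cop cop' by (auto simp: coproduct_def)
  have X: "X i \<in> ob K" "\<iota> i \<in> Hom K (X i) S" and X': "X' i \<in> ob K" "\<iota>' i \<in> Hom K (X' i) S'"
    if "i \<in> I" for i using cop cop' that by (auto simp: coproduct_def)
  let ?G = "\<lambda>i. hom_group K C (X i)" and ?G' = "\<lambda>i. hom_group K C' (X' i)"
  let ?u = "\<lambda>h. gfinprod (hom_group K C S) (\<lambda>i. \<iota> i \<cdot> h i) I"
  let ?u' = "\<lambda>h. gfinprod (hom_group K C' S') (\<lambda>i. \<iota>' i \<cdot> h i) I"
  have grp: "group (?G i)" and grp': "group (?G' i)" if "i \<in> I" for i
    using that X X' C C'ob by auto
  interpret HS: comm_group "hom_group K C S" using C S by simp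
  interpret HS': comm_group "hom_group K C' S'" using C'ob S' by simp
  have comp: "x i \<in> Hom K C (X i)" if "x \<in> carrier (sum_group I ?G)" "i \<in> I" for x i
    using that grp by (auto simp: carrier_sum_group PiE_def Pi_def)
  have comp': "x i \<in> Hom K C' (X' i)" if "x \<in> carrier (sum_group I ?G')" "i \<in> I" for x i
    using that grp' by (auto simp: carrier_sum_group PiE_def Pi_def)
  have fin: "finite {i \<in> I. \<iota> i \<cdot> x i \<noteq> zero_ar K C S}" if "x \<in> carrier (sum_group I ?G)" for x
  proof (rule finite_subset)
    show "{i \<in> I. \<iota> i \<cdot> x i \<noteq> zero_ar K C S} \<subseteq> {i \<in> I. x i \<noteq> \<one>\<^bsub>?G i\<^esub>}"
      using X C by (auto simp: cmp_zero_right)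
  qed (use that grp in \<open>simp add: carrier_sum_group\<close>)
  have fin': "finite {i \<in> I. \<iota>' i \<cdot> x i \<noteq> zero_ar K C' S'}" if "x \<in> carrier (sum_group I ?G')" for x
  proof (rule finite_subset)
    show "{i \<in> I. \<iota>' i \<cdot> x i \<noteq> zero_ar K C' S'} \<subseteq> {i \<in> I. x i \<noteq> \<one>\<^bsub>?G' i\<^esub>}"
      using X' C'ob by (auto simp: cmp_zero_right)
  qed (use that grp' in \<open>simp add: carrier_sum_group\<close>)
  show "?u \<in> iso (sum_group I ?G) (hom_group K C S)"
  proof (rule iso_retract)
    show "?u' \<in> iso (sum_group I ?G') (hom_group K C' S')"
      using C' I cop' by (simp add: compact_objects_def)
    show "?u \<in> hom (sum_group I ?G) (hom_group K C S)"
      by (rule HS.hom_group_sum[where f = "\<lambda>i h. \<iota> i \<cdot> h"]) (use C X grp in \<open>auto intro: postcompose_hom\<close>)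
    show "(\<lambda>i\<in>I. \<phi> i (x i)) \<in> carrier (sum_group I ?G')" if "x \<in> carrier (sum_group I ?G)" for x
      by (rule sum_group_map_carrier[OF grp grp' \<phi> that])
    show "(\<lambda>i\<in>I. \<psi> i (x i)) \<in> carrier (sum_group I ?G)" if "x \<in> carrier (sum_group I ?G')" for x
      by (rule sum_group_map_carrier[OF grp' grp \<psi> that])
    show "a y \<in> carrier (hom_group K C' S')" if "y \<in> carrier (hom_group K C S)" for y
      using a that by (auto simp: hom_def)
    show "(\<lambda>i\<in>I. \<psi> i ((\<lambda>i\<in>I. \<phi> i (x i)) i)) = x" if x: "x \<in> carrier (sum_group I ?G)" for x
    proof
      show "(\<lambda>i\<in>I. \<psi> i ((\<lambda>i\<in>I. \<phi> i (x i)) i)) i = x i" for i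
        using x grp comp[OF x] by (cases "i \<in> I") (auto simp: \<psi>\<phi> carrier_sum_group PiE_def extensional_def)
    qed
    show "b (a y) = y" if "y \<in> carrier (hom_group K C S)" for y using that ba by simp
    show "a (?u x) = ?u' (\<lambda>i\<in>I. \<phi> i (x i))" if x: "x \<in> carrier (sum_group I ?G)" for x
    proof -
      have aH: "\<iota>' i \<cdot> \<phi> i (x i) \<in> Hom K C' S'" if "i \<in> I" for i
        using hom_in_carrier[OF \<phi>[OF that]] comp[OF x that] X'(2)[OF that] by (auto intro: cmp_Hom)
      have "a (?u x) = gfinprod (hom_group K C' S') (\<lambda>i. a (\<iota> i \<cdot> x i)) I"
        by (rule gfinprod_hom[OF HS.comm_group_axioms HS'.comm_group_axioms a])
          (use fin[OF x] comp[OF x] X in \<open>auto intro: cmp_Hom\<close>)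
      also have "\<dots> = ?u' (\<lambda>i\<in>I. \<phi> i (x i))"
        by (rule HS'.gfinprod_cong)
          (use comp[OF x] aH in \<open>auto simp: a\<phi> simp_implies_def\<close>)
      finally show ?thesis .
    qed
    show "b (?u' x) = ?u (\<lambda>i\<in>I. \<psi> i (x i))" if x: "x \<in> carrier (sum_group I ?G')" for x
    proof -
      have bH: "\<iota> i \<cdot> \<psi> i (x i) \<in> Hom K C S" if "i \<in> I" for i
        using hom_in_carrier[OF \<psi>[OF that]] comp'[OF x that] X(2)[OF that] by (auto intro: cmp_Hom)
      have "b (?u' x) = gfinprod (hom_group K C S) (\<lambda>i. b (\<iota>' i \<cdot> x i)) I"
        by (rule gfinprod_hom[OF HS'.comm_group_axioms HS.comm_group_axioms b])
          (use fin'[OF x] comp'[OF x] X' in \<open>auto intro: cmp_Hom\<close>)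
      also have "\<dots> = ?u (\<lambda>i\<in>I. \<psi> i (x i))"
        by (rule HS.gfinprod_cong)
          (use comp'[OF x] bH in \<open>auto simp: b\<psi> simp_implies_def\<close>)
      finally show ?thesis .
    qed
  qed
qed

lemma compact_isomorphic:
  fixes U :: "'u set"
  assumes A: "A \<in> compact_objects K U" and "isomorphic K A B"
  shows "B \<in> compact_objects K U"
proof -
  obtain f g where f: "f \<in> Hom K A B" and g: "g \<in> Hom K B A" and fg: "f \<cdot> g = ide K B"
    using assms(2) unfolding isomorphic_def by (metis is_isoE)
  have inv: "(h \<cdot> f) \<cdot> g = h" if "h \<in> Hom K B Y" for h Y
    using cmp_assoc[OF g f that] cmp_ide_right[OF that] fg by simp
  show ?thesis
  proof (rule compact_retract[OF _ A])
    show "B \<in> ob K" using f Hom_ob by blast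
    fix I :: "'u set" and X S \<iota>
    assume cop: "coproduct K I X S \<iota>"
    then have S: "S \<in> ob K" and X: "\<And>i. i \<in> I \<Longrightarrow> X i \<in> ob K \<and> \<iota> i \<in> Hom K (X i) S"
      by (auto simp: coproduct_def)
    show "hom_retract K B A I X S \<iota>"
      unfolding hom_retract_def
      by (rule exI[of _ X], rule exI[of _ S], rule exI[of _ \<iota>],
          rule exI[of _ "\<lambda>_ h. h \<cdot> f"], rule exI[of _ "\<lambda>_ h. h \<cdot> g"],
          rule exI[of _ "\<lambda>h. h \<cdot> f"], rule exI[of _ "\<lambda>h. h \<cdot> g"])
        (use cop f g S X in \<open>auto intro!: precompose_hom intro: inv cmp_assoc\<close>)
  qed
qed

end

section \<open>Distinguished triangles\<close>

context triangulated_category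
begin

lemma shift_ob: "A \<in> ob K \<Longrightarrow> shift K A \<in> ob K"
  using shift_additive by (auto simp: additive_endofunctor_def endofunctor_def)

lemma shift_ide: "A \<in> ob K \<Longrightarrow> shift_ar K (ide K A) = ide K (shift K A)"
  using shift_additive by (auto simp: additive_endofunctor_def endofunctor_def)

lemma shift_Hom: "f \<in> Hom K A B \<Longrightarrow> shift_ar K f \<in> Hom K (shift K A) (shift K B)"
  using shift_additive by (auto simp: additive_endofunctor_def endofunctor_def)

lemma shift_cmp: "f \<in> Hom K A B \<Longrightarrow> g \<in> Hom K B C \<Longrightarrow> shift_ar K (g \<cdot> f) = shift_ar K g \<cdot> shift_ar K f"
  using shift_additive by (auto simp: additive_endofunctor_def endofunctor_def)

lemma shift_eqD:
  assumes "f \<in> Hom K A B" "g \<in> Hom K A B" "shift_ar K f = shift_ar K g"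
  shows "f = g"
  using shift_fully_faithful[OF Hom_ob[OF assms(1)]] assms by (meson bij_betw_def inj_onD)

lemma dist_Hom:
  assumes "(f, g, h) \<in> dist K"
  shows "f \<in> Hom K (src K f) (src K g)" "g \<in> Hom K (src K g) (src K h)"
    "h \<in> Hom K (src K h) (shift K (src K f))"
  using dist_triangle[OF assms] by (auto simp: triangle_def Hom_def)

text \<open>Compare the triangle with \<open>A \<rightarrow> A \<rightarrow> 0 \<rightarrow> \<Sigma>A\<close>, where \<open>A\<close> is the source of \<open>f\<close>.\<close>

lemma dist_cmp_zero:
  assumes D: "(f, g, h) \<in> dist K"
  shows "g \<cdot> f = zero_ar K (src K f) (src K h)"
proof -
  obtain Z where Z: "zero_object K Z" using ex_zero_object by blast
  then have Zob: "Z \<in> ob K" by (simp add: zero_object_def)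
  let ?A = "src K f"
  note H = dist_Hom[OF D]
  have A: "?A \<in> ob K" using H Hom_ob by blast
  have srcs: "src K (ide K ?A) = ?A" "src K (zero_ar K ?A Z) = ?A"
      "src K (zero_ar K Z (shift K ?A)) = Z"
    using zero_ar_Hom A Zob shift_ob ide_Hom[OF A] by (auto simp: Hom_def)
  obtain c where "c \<in> Hom K Z (src K h)" "c \<cdot> zero_ar K ?A Z = g \<cdot> f"
    using dist_morphism[OF dist_ide[OF A Z] D, of "ide K ?A" f] H A srcs ide_Hom[OF A] by auto
  then show ?thesis using cmp_zero_right[OF A] by metis
qed

text \<open>Compare the triangle with \<open>0 \<rightarrow> Y \<rightarrow> Y \<rightarrow> \<Sigma>0\<close>.\<close>

lemma dist_weak_cokernel:
  assumes D: "(f, g, h) \<in> dist K" and x: "x \<in> Hom K (src K g) Y" "x \<cdot> f = zero_ar K (src K f) Y"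
  obtains y where "y \<in> Hom K (src K h) Y" "y \<cdot> g = x"
proof -
  obtain Z where Z: "zero_object K Z" using ex_zero_object by blast
  then have Zob: "Z \<in> ob K" by (simp add: zero_object_def)
  note H = dist_Hom[OF D]
  have A: "src K f \<in> ob K" and Y: "Y \<in> ob K" using H x Hom_ob by blast+
  have SZ: "zero_object K (shift K Z)" using additive_endofunctor_zero_object[OF shift_additive Z] .
  have H0: "zero_ar K Z Y \<in> Hom K Z Y" "zero_ar K Y (shift K Z) \<in> Hom K Y (shift K Z)"
    using zero_ar_Hom Zob Y shift_ob by auto
  have n: "neg_ar K (shift_ar K (zero_ar K Z Y)) \<in> Hom K (shift K Z) (shift K Y)"
    "zero_ar K (shift K Z) (shift K Y) \<in> Hom K (shift K Z) (shift K Y)"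
    using neg_ar_Hom[OF shift_Hom[OF H0(1)]] zero_ar_Hom Zob Y shift_ob by auto
  then have eq: "neg_ar K (shift_ar K (zero_ar K Z Y)) = zero_ar K (shift K Z) (shift K Y)"
    using SZ shift_ob[OF Y] by (auto simp: zero_object_def)
  have "triangle K (zero_ar K Z Y) (ide K Y) (zero_ar K Y (shift K Z))"
    using H0 ide_Hom[OF Y] by (auto simp: triangle_def Hom_def)
  then have D': "(zero_ar K Z Y, ide K Y, zero_ar K Y (shift K Z)) \<in> dist K"
    using dist_rotate dist_ide[OF Y SZ] eq by simp
  have srcs: "src K (zero_ar K Z Y) = Z" "src K (ide K Y) = Y" "src K (zero_ar K Y (shift K Z)) = Y"
    using H0 ide_Hom[OF Y] by (auto simp: Hom_def)
  have "x \<cdot> f = zero_ar K Z Y \<cdot> zero_ar K (src K f) Z"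
    using x cmp_zero_left[OF Y zero_ar_Hom[OF A Zob]] by simp
  then obtain c where "c \<in> Hom K (src K h) Y" "c \<cdot> g = ide K Y \<cdot> x"
    using dist_morphism[OF D D', of "zero_ar K (src K f) Z" x] x srcs zero_ar_Hom[OF A Zob] by auto
  then show ?thesis using that x cmp_ide_left by metis
qed

text \<open>Rigidity produces an object as a retract of another, whereas thickness speaks of biproducts. In a
  triangulated category the two agree, the complement being the cone \<open>C\<close> of the section: the
  connecting arrow \<open>C \<rightarrow> \<Sigma>A\<close> vanishes, so \<open>P \<rightarrow> C\<close> is an epimorphism, and the idempotent \<open>1 - sr\<close>, which
  kills \<open>s\<close>, factors through it as \<open>j g\<close>.\<close>

lemma split_mono_direct_summand:
  assumes s: "s \<in> Hom K A P" and r: "r \<in> Hom K P A" and rs: "r \<cdot> s = ide K A"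
  shows "direct_summand K A P"
proof -
  obtain g h where D: "(s, g, h) \<in> dist K" using dist_ex[of s] s by (auto simp: Hom_def)
  note H = dist_Hom[OF D]
  define C where "C = src K h"
  have srcs: "src K s = A" "src K g = P" "src K r = P" "src K h = C"
    using s r H C_def by (auto simp: Hom_def)
  have g: "g \<in> Hom K P C" and h: "h \<in> Hom K C (shift K A)" using H srcs by auto
  have ob: "A \<in> ob K" "P \<in> ob K" "C \<in> ob K" using s g Hom_ob by blast+
  have gs: "g \<cdot> s = zero_ar K A C" using dist_cmp_zero[OF D] srcs by simp
  \<comment> \<open>The splitting extends to a morphism onto \<open>A \<rightarrow> A \<rightarrow> 0 \<rightarrow> \<Sigma>A\<close>, so the connecting arrow vanishes.\<close>
  have h0: "h = zero_ar K C (shift K A)"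
  proof -
    obtain Z where Z: "zero_object K Z" using ex_zero_object by blast
    then have Zob: "Z \<in> ob K" by (simp add: zero_object_def)
    have H0: "zero_ar K A Z \<in> Hom K A Z" "zero_ar K Z (shift K A) \<in> Hom K Z (shift K A)"
      using zero_ar_Hom Zob ob shift_ob by auto
    then have "src K (zero_ar K A Z) = A" "src K (zero_ar K Z (shift K A)) = Z" "src K (ide K A) = A"
      using ide_Hom[OF ob(1)] by (auto simp: Hom_def)
    then obtain c where c: "c \<in> Hom K C Z" "shift_ar K (ide K A) \<cdot> h = zero_ar K Z (shift K A) \<cdot> c"
      using dist_morphism[OF D dist_ide[OF ob(1) Z], of "ide K A" r] srcs ide_Hom[OF ob(1)] r rs
        cmp_ide_left[OF ide_Hom[OF ob(1)]] by auto
    then show ?thesis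
      using cmp_zero_left[OF shift_ob[OF ob(1)] c(1)] shift_ide[OF ob(1)] cmp_ide_left[OF h] by simp
  qed
  have epi0: "x = zero_ar K C Y" if x: "x \<in> Hom K C Y" "x \<cdot> g = zero_ar K P Y" for x Y
  proof -
    have "(g, h, neg_ar K (shift_ar K s)) \<in> dist K"
      using dist_rotate[OF dist_triangle[OF D]] D by simp
    moreover have "src K (neg_ar K (shift_ar K s)) = shift K A"
      using neg_ar_Hom[OF shift_Hom[OF s]] by (simp add: Hom_def)
    ultimately obtain y where "y \<in> Hom K (shift K A) Y" "y \<cdot> h = x"
      using dist_weak_cokernel[of g h _ x Y] x srcs by metis
    then show ?thesis using h0 cmp_zero_right[OF ob(3)] by metis
  qed
  have epi: "x = y" if x: "x \<in> Hom K C Y" "y \<in> Hom K C Y" "x \<cdot> g = y \<cdot> g" for x y Y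
  proof -
    obtain z where z: "z \<in> Hom K C Y" "y \<boxplus> z = x" using ex_difference[OF x(2,1)] .
    have "(y \<cdot> g) \<boxplus> (z \<cdot> g) = y \<cdot> g" using cmp_add_left[OF g x(2) z(1)] z x by simp
    then have "z \<cdot> g = zero_ar K P Y" using add_ar_eq_self cmp_Hom g x z by metis
    then show ?thesis using epi0[OF z(1)] z x add_ar_zero by metis
  qed
  have sr: "s \<cdot> r \<in> Hom K P P" using r s by (rule cmp_Hom)
  \<comment> \<open>\<open>n\<close> is the complementary idempotent \<open>1 - sr\<close>.\<close>
  obtain n where n: "n \<in> Hom K P P" "(s \<cdot> r) \<boxplus> n = ide K P"
    using ex_difference[OF sr ide_Hom[OF ob(2)]] .
  have "s \<boxplus> (n \<cdot> s) = s"
    using cmp_add_left[OF s sr n(1)] n(2) cmp_ide_left[OF s] cmp_assoc[OF s r s] rs cmp_ide_right[OF s]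
    by simp
  then have "n \<cdot> s = zero_ar K A P" using add_ar_eq_self[OF s] cmp_Hom[OF s n(1)] by simp
  then obtain j where j: "j \<in> Hom K C P" "j \<cdot> g = n"
    using dist_weak_cokernel[OF D, of n P] n srcs by auto
  have "r \<boxplus> (r \<cdot> n) = r"
    using cmp_add_right[OF sr n(1) r] n(2) cmp_ide_right[OF r] cmp_assoc[OF r s r] rs cmp_ide_left[OF r]
    by simp
  then have "r \<cdot> n = zero_ar K P A" using add_ar_eq_self[OF r] cmp_Hom[OF n(1) r] by simp
  then have rj: "r \<cdot> j = zero_ar K C A"
    using epi0[OF cmp_Hom[OF j(1) r]] cmp_assoc[OF g j(1) r] j(2) by simp
  have "g \<cdot> n = g"
    using cmp_add_right[OF sr n(1) g] n(2) cmp_ide_right[OF g] cmp_assoc[OF r s g] gs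
      cmp_zero_left[OF ob(3) r] add_ar_zero(2)[OF cmp_Hom[OF n(1) g]] by simp
  then have "(g \<cdot> j) \<cdot> g = ide K C \<cdot> g" using cmp_assoc[OF g j(1) g] j(2) cmp_ide_left[OF g] by simp
  then have gj: "g \<cdot> j = ide K C" using epi[OF cmp_Hom[OF j(1) g] ide_Hom[OF ob(3)]] by simp
  have "biproduct K A C P"
    unfolding biproduct_def using ob s r g j(1) rs gj rj gs n(2) j(2) by blast
  then show ?thesis by (auto simp: direct_summand_def)
qed

definition unshift :: "'o \<Rightarrow> 'o \<Rightarrow> 'm \<Rightarrow> 'm" where
  "unshift A B = inv_into (Hom K A B) (shift_ar K)"

lemma shift_unshift:
  assumes "A \<in> ob K" "B \<in> ob K" "h \<in> Hom K (shift K A) (shift K B)"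
  shows "unshift A B h \<in> Hom K A B" "shift_ar K (unshift A B h) = h"
proof -
  have "h \<in> shift_ar K ` Hom K A B"
    using shift_fully_faithful[OF assms(1,2)] assms(3) by (simp add: bij_betw_def)
  then show "unshift A B h \<in> Hom K A B" "shift_ar K (unshift A B h) = h"
    unfolding unshift_def by (rule inv_into_into, rule f_inv_into_f)
qed

lemma shift_add: "f \<in> Hom K A B \<Longrightarrow> g \<in> Hom K A B \<Longrightarrow> shift_ar K (f \<boxplus> g) = shift_ar K f \<boxplus> shift_ar K g"
  using shift_additive by (auto simp: additive_endofunctor_def)

lemma unshift_hom:
  assumes "A \<in> ob K" "B \<in> ob K"
  shows "unshift A B \<in> hom (hom_group K (shift K A) (shift K B)) (hom_group K A B)"
proof (rule homI)
  fix x y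
  assume "x \<in> carrier (hom_group K (shift K A) (shift K B))" "y \<in> carrier (hom_group K (shift K A) (shift K B))"
  then have xy: "x \<in> Hom K (shift K A) (shift K B)" "y \<in> Hom K (shift K A) (shift K B)" by auto
  note u = shift_unshift[OF assms xy(1)] shift_unshift[OF assms xy(2)]
    shift_unshift[OF assms add_ar_Hom[OF xy]]
  have "unshift A B (x \<boxplus> y) = unshift A B x \<boxplus> unshift A B y"
    by (rule shift_eqD[of _ A B]) (use u shift_add add_ar_Hom in auto)
  then show "unshift A B (x \<otimes>\<^bsub>hom_group K (shift K A) (shift K B)\<^esub> y)
      = unshift A B x \<otimes>\<^bsub>hom_group K A B\<^esub> unshift A B y" by simp
qed (use shift_unshift[OF assms] in auto)

text \<open>The shift is an equivalence, so any coproduct is, up to isomorphism, the shift of a coproduct: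
  the universal property of \<open>S\<close> with values in \<open>\<Sigma>Y\<close> is that of \<open>S'\<close> with values in \<open>Y\<close>.\<close>

lemma coproduct_unshift:
  assumes cop: "coproduct K I X S \<iota>"
  obtains X' S' \<iota>' \<alpha> \<alpha>' \<beta> \<beta>' where "coproduct K I X' S' \<iota>'"
    "\<And>i. i \<in> I \<Longrightarrow> \<alpha> i \<in> Hom K (shift K (X' i)) (X i)" "\<And>i. i \<in> I \<Longrightarrow> \<alpha>' i \<in> Hom K (X i) (shift K (X' i))"
    "\<And>i. i \<in> I \<Longrightarrow> \<alpha>' i \<cdot> \<alpha> i = ide K (shift K (X' i))" "\<And>i. i \<in> I \<Longrightarrow> \<alpha> i \<cdot> \<alpha>' i = ide K (X i)"
    "\<beta> \<in> Hom K (shift K S') S" "\<beta>' \<in> Hom K S (shift K S')"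
    "\<beta>' \<cdot> \<beta> = ide K (shift K S')" "\<beta> \<cdot> \<beta>' = ide K S"
    "\<And>i. i \<in> I \<Longrightarrow> \<beta> \<cdot> shift_ar K (\<iota>' i) = \<iota> i \<cdot> \<alpha> i"
proof -
  have S: "S \<in> ob K" and X: "\<And>i. i \<in> I \<Longrightarrow> X i \<in> ob K" "\<And>i. i \<in> I \<Longrightarrow> \<iota> i \<in> Hom K (X i) S"
    using cop by (auto simp: coproduct_def)
  have ex: "\<exists>p. fst p \<in> ob K \<and> fst (snd p) \<in> Hom K (shift K (fst p)) Y \<and> snd (snd p) \<in> Hom K Y (shift K (fst p)) \<and>
      snd (snd p) \<cdot> fst (snd p) = ide K (shift K (fst p)) \<and> fst (snd p) \<cdot> snd (snd p) = ide K Y"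
    if Y: "Y \<in> ob K" for Y
  proof -
    obtain Y' f where "Y' \<in> ob K" "f \<in> Hom K (shift K Y') Y" "is_iso K f"
      using shift_ess_surj[OF Y] by (auto simp: isomorphic_def)
    moreover then obtain g where "g \<in> Hom K Y (shift K Y')" "g \<cdot> f = ide K (shift K Y')" "f \<cdot> g = ide K Y"
      by (auto elim: is_isoE)
    ultimately show ?thesis by (intro exI[of _ "(Y', f, g)"]) simp
  qed
  obtain p where p: "\<forall>Y\<in>ob K. fst (p Y) \<in> ob K \<and> fst (snd (p Y)) \<in> Hom K (shift K (fst (p Y))) Y \<and>
      snd (snd (p Y)) \<in> Hom K Y (shift K (fst (p Y))) \<and>
      snd (snd (p Y)) \<cdot> fst (snd (p Y)) = ide K (shift K (fst (p Y))) \<and>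
      fst (snd (p Y)) \<cdot> snd (snd (p Y)) = ide K Y"
    by (rule exE[OF bchoice[OF ballI[OF ex]]])
  define X' \<alpha> \<alpha>' where "X' i = fst (p (X i))" and "\<alpha> i = fst (snd (p (X i)))"
    and "\<alpha>' i = snd (snd (p (X i)))" for i
  have X': "X' i \<in> ob K" and \<alpha>: "\<alpha> i \<in> Hom K (shift K (X' i)) (X i)" and \<alpha>': "\<alpha>' i \<in> Hom K (X i) (shift K (X' i))"
    and \<alpha>'\<alpha>: "\<alpha>' i \<cdot> \<alpha> i = ide K (shift K (X' i))" and \<alpha>\<alpha>': "\<alpha> i \<cdot> \<alpha>' i = ide K (X i)" if "i \<in> I" for i
    using bspec[OF p X(1)[OF that]] by (auto simp: X'_def \<alpha>_def \<alpha>'_def)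
  obtain S' \<beta> \<beta>' where S': "S' \<in> ob K" and \<beta>: "\<beta> \<in> Hom K (shift K S') S" and \<beta>': "\<beta>' \<in> Hom K S (shift K S')"
    and \<beta>'\<beta>: "\<beta>' \<cdot> \<beta> = ide K (shift K S')" and \<beta>\<beta>': "\<beta> \<cdot> \<beta>' = ide K S"
    using ex[OF S] by auto
  define \<iota>' where "\<iota>' i = unshift (X' i) S' (\<beta>' \<cdot> (\<iota> i \<cdot> \<alpha> i))" for i
  have \<iota>': "\<iota>' i \<in> Hom K (X' i) S'" and S\<iota>': "shift_ar K (\<iota>' i) = \<beta>' \<cdot> (\<iota> i \<cdot> \<alpha> i)" if "i \<in> I" for i
    using shift_unshift[OF X'[OF that] S' cmp_Hom[OF cmp_Hom[OF \<alpha> X(2)] \<beta>']] that by (auto simp: \<iota>'_def)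
  have \<beta>\<iota>': "\<beta> \<cdot> shift_ar K (\<iota>' i) = \<iota> i \<cdot> \<alpha> i" if "i \<in> I" for i
    using S\<iota>' cmp_assoc[OF cmp_Hom[OF \<alpha> X(2)] \<beta>' \<beta>, of i] \<beta>\<beta>' cmp_ide_left[OF cmp_Hom[OF \<alpha> X(2)], of i] that by simp
  have "coproduct K I X' S' \<iota>'"
    unfolding coproduct_def
  proof (intro conjI ballI allI impI)
    fix Y g assume Y: "Y \<in> ob K" and "\<forall>i\<in>I. g i \<in> Hom K (X' i) Y"
    then have g: "\<And>i. i \<in> I \<Longrightarrow> g i \<in> Hom K (X' i) Y" by blast
    let ?g = "\<lambda>i. shift_ar K (g i) \<cdot> \<alpha>' i"
    have gH: "\<forall>i\<in>I. ?g i \<in> Hom K (X i) (shift K Y)" using cmp_Hom[OF \<alpha>' shift_Hom[OF g]] by blast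
    have univ: "\<exists>!u. u \<in> Hom K S (shift K Y) \<and> (\<forall>i\<in>I. u \<cdot> \<iota> i = ?g i)"
      using cop shift_ob[OF Y] gH by (auto simp: coproduct_def)
    have transfer: "v \<cdot> \<iota>' i = g i \<longleftrightarrow> (shift_ar K v \<cdot> \<beta>') \<cdot> \<iota> i = ?g i"
      if v: "v \<in> Hom K S' Y" and i: "i \<in> I" for v i
    proof -
      have Sv: "shift_ar K (v \<cdot> \<iota>' i) = ((shift_ar K v \<cdot> \<beta>') \<cdot> \<iota> i) \<cdot> \<alpha> i"
        using shift_cmp[OF \<iota>'[OF i] v] S\<iota>'[OF i] shift_Hom[OF v] \<beta>' X(2)[OF i] \<alpha>[OF i]
        by (simp add: Hom_def arrow_simps)
      show ?thesis
      proof
        assume eq: "v \<cdot> \<iota>' i = g i"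
        have vH: "(shift_ar K v \<cdot> \<beta>') \<cdot> \<iota> i \<in> Hom K (X i) (shift K Y)"
          using cmp_Hom[OF X(2)[OF i] cmp_Hom[OF \<beta>' shift_Hom[OF v]]] .
        show "(shift_ar K v \<cdot> \<beta>') \<cdot> \<iota> i = ?g i"
          using Sv eq cmp_assoc[OF \<alpha>'[OF i] \<alpha>[OF i] vH] \<alpha>\<alpha>'[OF i] cmp_ide_right[OF vH] by simp
      next
        assume eq: "(shift_ar K v \<cdot> \<beta>') \<cdot> \<iota> i = ?g i"
        have "shift_ar K (v \<cdot> \<iota>' i) = shift_ar K (g i)"
          using Sv eq cmp_assoc[OF \<alpha>[OF i] \<alpha>'[OF i] shift_Hom[OF g[OF i]]] \<alpha>'\<alpha>[OF i]
            cmp_ide_right[OF shift_Hom[OF g[OF i]]] by simp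
        then show "v \<cdot> \<iota>' i = g i" using shift_eqD[OF cmp_Hom[OF \<iota>'[OF i] v] g[OF i]] by blast
      qed
    qed
    obtain u where u: "u \<in> Hom K S (shift K Y)" "\<forall>i\<in>I. u \<cdot> \<iota> i = ?g i" using univ by blast
    note u' = shift_unshift[OF S' Y cmp_Hom[OF \<beta> u(1)]]
    have u'\<beta>': "shift_ar K (unshift S' Y (u \<cdot> \<beta>)) \<cdot> \<beta>' = u"
      using u'(2) cmp_assoc[OF \<beta>' \<beta> u(1)] \<beta>\<beta>' cmp_ide_right[OF u(1)] by simp
    show "\<exists>!u. u \<in> Hom K S' Y \<and> (\<forall>i\<in>I. u \<cdot> \<iota>' i = g i)"
    proof (rule ex1I[of _ "unshift S' Y (u \<cdot> \<beta>)"])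
      show "unshift S' Y (u \<cdot> \<beta>) \<in> Hom K S' Y \<and> (\<forall>i\<in>I. unshift S' Y (u \<cdot> \<beta>) \<cdot> \<iota>' i = g i)"
        using u' transfer u'\<beta>' u(2) by simp
      fix v assume v: "v \<in> Hom K S' Y \<and> (\<forall>i\<in>I. v \<cdot> \<iota>' i = g i)"
      have "shift_ar K v \<cdot> \<beta>' \<in> Hom K S (shift K Y)" "\<forall>i\<in>I. (shift_ar K v \<cdot> \<beta>') \<cdot> \<iota> i = ?g i"
        using v transfer cmp_Hom[OF \<beta>' shift_Hom] by auto
      then have vu: "shift_ar K v \<cdot> \<beta>' = u" using univ u by (metis (no_types, lifting))
      have "shift_ar K v = u \<cdot> \<beta>"
        using cmp_assoc[OF \<beta> \<beta>' shift_Hom, of v Y] v vu \<beta>'\<beta> cmp_ide_right[OF shift_Hom, of v S' Y] by simp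
      then show "v = unshift S' Y (u \<cdot> \<beta>)" using shift_eqD[of v S' Y] v u' by simp
    qed
  qed (use X' S' \<iota>' in auto)
  from that[OF this \<alpha> \<alpha>' \<alpha>'\<alpha> \<alpha>\<alpha>' \<beta> \<beta>' \<beta>'\<beta> \<beta>\<beta>' \<beta>\<iota>'] show ?thesis .
qed

text \<open>An arrow out of \<open>\<Sigma>A\<close> is moved into the shifted coproduct by \<open>\<alpha>'\<close> or \<open>\<beta>'\<close> and then unshifted (\<open>\<phi>\<close>); an
  arrow out of \<open>A\<close> is shifted and moved back by \<open>\<alpha>\<close> or \<open>\<beta>\<close> (\<open>\<psi>\<close>).\<close>

lemma compact_shift:
  fixes U :: "'u set"
  assumes A: "A \<in> compact_objects K U"
  shows "shift K A \<in> compact_objects K U"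
proof (rule compact_retract[OF _ A])
  have Aob: "A \<in> ob K" using A by (simp add: compact_objects_def)
  then show "shift K A \<in> ob K" by (rule shift_ob)
  fix I :: "'u set" and X S \<iota>
  assume cop: "coproduct K I X S \<iota>"
  obtain X' S' \<iota>' \<alpha> \<alpha>' \<beta> \<beta>' where cop': "coproduct K I X' S' \<iota>'"
    and \<alpha>: "\<And>i. i \<in> I \<Longrightarrow> \<alpha> i \<in> Hom K (shift K (X' i)) (X i)" and \<alpha>': "\<And>i. i \<in> I \<Longrightarrow> \<alpha>' i \<in> Hom K (X i) (shift K (X' i))"
    and \<alpha>'\<alpha>: "\<And>i. i \<in> I \<Longrightarrow> \<alpha>' i \<cdot> \<alpha> i = ide K (shift K (X' i))" and \<alpha>\<alpha>': "\<And>i. i \<in> I \<Longrightarrow> \<alpha> i \<cdot> \<alpha>' i = ide K (X i)"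
    and \<beta>: "\<beta> \<in> Hom K (shift K S') S" and \<beta>': "\<beta>' \<in> Hom K S (shift K S')"
    and \<beta>'\<beta>: "\<beta>' \<cdot> \<beta> = ide K (shift K S')" and \<beta>\<beta>': "\<beta> \<cdot> \<beta>' = ide K S"
    and \<beta>\<iota>': "\<And>i. i \<in> I \<Longrightarrow> \<beta> \<cdot> shift_ar K (\<iota>' i) = \<iota> i \<cdot> \<alpha> i"
    by (rule coproduct_unshift[OF cop]) blast
  have S: "S \<in> ob K" "S' \<in> ob K" and X: "\<And>i. i \<in> I \<Longrightarrow> X i \<in> ob K" "\<And>i. i \<in> I \<Longrightarrow> X' i \<in> ob K"
      "\<And>i. i \<in> I \<Longrightarrow> \<iota> i \<in> Hom K (X i) S" "\<And>i. i \<in> I \<Longrightarrow> \<iota>' i \<in> Hom K (X' i) S'"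
    using cop cop' by (auto simp: coproduct_def)
  define \<phi> where "\<phi> Y' c h = unshift A Y' (c \<cdot> h)" for Y' c h
  define \<psi> where "\<psi> c k = c \<cdot> shift_ar K k" for c k
  have \<phi>: "\<phi> Y' c \<in> hom (hom_group K (shift K A) Y) (hom_group K A Y')"
    if "Y' \<in> ob K" "c \<in> Hom K Y (shift K Y')" for Y Y' c
    using hom_compose[OF postcompose_hom[OF shift_ob[OF Aob] that(2)] unshift_hom[OF Aob that(1)]]
    unfolding \<phi>_def o_def .
  have \<psi>: "\<psi> c \<in> hom (hom_group K A Y') (hom_group K (shift K A) Y)"
    if "Y' \<in> ob K" "c \<in> Hom K (shift K Y') Y" for Y Y' c
    using hom_compose[OF additive_endofunctor_hom[OF shift_additive Aob that(1)]
        postcompose_hom[OF shift_ob[OF Aob] that(2)]]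
    unfolding \<psi>_def o_def .
  have S\<phi>: "\<phi> Y' c h \<in> Hom K A Y'" "shift_ar K (\<phi> Y' c h) = c \<cdot> h"
    if "Y' \<in> ob K" "c \<in> Hom K Y (shift K Y')" "h \<in> Hom K (shift K A) Y" for Y Y' c h
    using shift_unshift[OF Aob that(1) cmp_Hom[OF that(3,2)]] by (auto simp: \<phi>_def)
  have \<psi>\<phi>: "\<psi> d (\<phi> Y' c h) = h"
    if "Y' \<in> ob K" "c \<in> Hom K Y (shift K Y')" "d \<in> Hom K (shift K Y') Y" "d \<cdot> c = ide K Y"
      "h \<in> Hom K (shift K A) Y" for Y Y' c d h
    using S\<phi>(2)[OF that(1,2,5)] cmp_assoc[OF that(5,2,3)] that(4) cmp_ide_left[OF that(5)] by (simp add: \<psi>_def)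
  have nat\<psi>: "\<psi> \<beta> (\<iota>' i \<cdot> k) = \<iota> i \<cdot> \<psi> (\<alpha> i) k" if i: "i \<in> I" and k: "k \<in> Hom K A (X' i)" for i k
    using shift_cmp[OF k X(4)[OF i]] cmp_assoc[OF shift_Hom[OF k] shift_Hom[OF X(4)[OF i]] \<beta>]
      cmp_assoc[OF shift_Hom[OF k] \<alpha>[OF i] X(3)[OF i]] \<beta>\<iota>'[OF i] by (simp add: \<psi>_def)
  have nat\<phi>: "\<phi> S' \<beta>' (\<iota> i \<cdot> h) = \<iota>' i \<cdot> \<phi> (X' i) (\<alpha>' i) h" if i: "i \<in> I" and h: "h \<in> Hom K (shift K A) (X i)" for i h
  proof (rule shift_eqD)
    note p = S\<phi>[OF X(2)[OF i] \<alpha>'[OF i] h]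
    note q = S\<phi>[OF S(2) \<beta>' cmp_Hom[OF h X(3)[OF i]]]
    show "\<phi> S' \<beta>' (\<iota> i \<cdot> h) \<in> Hom K A S'" "\<iota>' i \<cdot> \<phi> (X' i) (\<alpha>' i) h \<in> Hom K A S'"
      using q(1) cmp_Hom[OF p(1) X(4)[OF i]] by auto
    have "\<psi> \<beta> (\<iota>' i \<cdot> \<phi> (X' i) (\<alpha>' i) h) = \<iota> i \<cdot> h"
      using nat\<psi>[OF i p(1)] \<psi>\<phi>[OF X(2)[OF i] \<alpha>'[OF i] \<alpha>[OF i] \<alpha>\<alpha>'[OF i] h] by simp
    then have "\<beta>' \<cdot> (\<beta> \<cdot> shift_ar K (\<iota>' i \<cdot> \<phi> (X' i) (\<alpha>' i) h)) = \<beta>' \<cdot> (\<iota> i \<cdot> h)"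
      by (simp add: \<psi>_def)
    then show "shift_ar K (\<phi> S' \<beta>' (\<iota> i \<cdot> h)) = shift_ar K (\<iota>' i \<cdot> \<phi> (X' i) (\<alpha>' i) h)"
      using q(2) cmp_assoc[OF shift_Hom[OF cmp_Hom[OF p(1) X(4)[OF i]]] \<beta> \<beta>'] \<beta>'\<beta>
        cmp_ide_left[OF shift_Hom[OF cmp_Hom[OF p(1) X(4)[OF i]]]] by simp
  qed
  show "hom_retract K (shift K A) A I X S \<iota>"
    unfolding hom_retract_def
  proof (intro exI conjI ballI)
    show "coproduct K I X' S' \<iota>'" by fact
    show "\<phi> (X' i) (\<alpha>' i) \<in> hom (hom_group K (shift K A) (X i)) (hom_group K A (X' i))"
      "\<psi> (\<alpha> i) \<in> hom (hom_group K A (X' i)) (hom_group K (shift K A) (X i))" if "i \<in> I" for i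
      using \<phi>[OF X(2)[OF that] \<alpha>'[OF that]] \<psi>[OF X(2)[OF that] \<alpha>[OF that]] .
    show "\<psi> (\<alpha> i) (\<phi> (X' i) (\<alpha>' i) h) = h" if "i \<in> I" "h \<in> Hom K (shift K A) (X i)" for i h
      using \<psi>\<phi>[OF X(2) \<alpha>' \<alpha> \<alpha>\<alpha>'] that by blast
    show "\<phi> S' \<beta>' (\<iota> i \<cdot> h) = \<iota>' i \<cdot> \<phi> (X' i) (\<alpha>' i) h"
      if "i \<in> I" "h \<in> Hom K (shift K A) (X i)" for i h
      using nat\<phi>[OF that] .
    show "\<psi> \<beta> (\<iota>' i \<cdot> k) = \<iota> i \<cdot> \<psi> (\<alpha> i) k" if "i \<in> I" "k \<in> Hom K A (X' i)" for i k
      using nat\<psi>[OF that] .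
    show "\<phi> S' \<beta>' \<in> hom (hom_group K (shift K A) S) (hom_group K A S')"
      "\<psi> \<beta> \<in> hom (hom_group K A S') (hom_group K (shift K A) S)"
      using \<phi>[OF S(2) \<beta>'] \<psi>[OF S(2) \<beta>] .
    show "\<psi> \<beta> (\<phi> S' \<beta>' h) = h" if "h \<in> Hom K (shift K A) S" for h
      using \<psi>\<phi>[OF S(2) \<beta>' \<beta> \<beta>\<beta>' that] .
  qed
qed

end

section \<open>The tensor product\<close>

context tensor_triangulated_category
begin

lemma tensor_additive_right:
  "A \<in> ob K \<Longrightarrow> additive_endofunctor K (\<lambda>X. A \<boxtimes> X) (\<lambda>f. ide K A \<boxdot> f)"
  using tensor_exact_right by (auto simp: exact_endofunctor_def)

lemma tensor_additive_left:
  "A \<in> ob K \<Longrightarrow> additive_endofunctor K (\<lambda>X. X \<boxtimes> A) (\<lambda>f. f \<boxdot> ide K A)"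
  using tensor_exact_left by (auto simp: exact_endofunctor_def)

lemma lunit_Hom: "A \<in> ob K \<Longrightarrow> lunit K A \<in> Hom K (\<I> \<boxtimes> A) A" and lunit_iso: "A \<in> ob K \<Longrightarrow> is_iso K (lunit K A)"
  and lunit_natural: "f \<in> Hom K A B \<Longrightarrow> lunit K B \<cdot> (ide K \<I> \<boxdot> f) = f \<cdot> lunit K A"
  using lunit_natural_iso by (auto simp: natural_iso_def)

lemma runit_Hom: "A \<in> ob K \<Longrightarrow> runit K A \<in> Hom K (A \<boxtimes> \<I>) A" and runit_iso: "A \<in> ob K \<Longrightarrow> is_iso K (runit K A)"
  using runit_natural_iso by (auto simp: natural_iso_def)

lemma assoc_isomorphic:
  "A \<in> ob K \<Longrightarrow> B \<in> ob K \<Longrightarrow> C \<in> ob K \<Longrightarrow> isomorphic K ((A \<boxtimes> B) \<boxtimes> C) (A \<boxtimes> (B \<boxtimes> C))"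
  using assoc_Hom assoc_iso isomorphicI by blast

lemma braid_isomorphic: "A \<in> ob K \<Longrightarrow> B \<in> ob K \<Longrightarrow> isomorphic K (A \<boxtimes> B) (B \<boxtimes> A)"
  using braid_Hom braid_iso isomorphicI by blast

lemma tensor_isomorphic_left:
  "C \<in> ob K \<Longrightarrow> isomorphic K A B \<Longrightarrow> isomorphic K (A \<boxtimes> C) (B \<boxtimes> C)"
  using endofunctor_isomorphic tensor_additive_left unfolding additive_endofunctor_def by blast

lemma inv_assoc_natural:
  assumes f: "f \<in> Hom K A A'" and g: "g \<in> Hom K B B'" and h: "h \<in> Hom K C C'"
  shows "inv_ar K (assoc K A' B' C') \<cdot> (f \<boxdot> (g \<boxdot> h)) = ((f \<boxdot> g) \<boxdot> h) \<cdot> inv_ar K (assoc K A B C)"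
proof -
  have ob: "A \<in> ob K" "B \<in> ob K" "C \<in> ob K" "A' \<in> ob K" "B' \<in> ob K" "C' \<in> ob K"
    using f g h Hom_ob by blast+
  let ?a = "assoc K A B C" and ?a' = "assoc K A' B' C'"
  let ?F = "f \<boxdot> (g \<boxdot> h)" and ?G = "(f \<boxdot> g) \<boxdot> h"
  note a = assoc_Hom[OF ob(1-3)] and i = inv_ar_Hom[OF assoc_iso[OF ob(1-3)] assoc_Hom[OF ob(1-3)]]
  note a' = assoc_Hom[OF ob(4-6)] and i' = inv_ar_Hom[OF assoc_iso[OF ob(4-6)] assoc_Hom[OF ob(4-6)]]
  note F = tensor_Hom[OF f tensor_Hom[OF g h]] and G = tensor_Hom[OF tensor_Hom[OF f g] h]
  have "inv_ar K ?a' \<cdot> ?F = inv_ar K ?a' \<cdot> ((?F \<cdot> ?a) \<cdot> inv_ar K ?a)"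
    using cmp_assoc[OF i(1) a F] i(3) cmp_ide_right[OF F] by simp
  also have "\<dots> = inv_ar K ?a' \<cdot> (?a' \<cdot> (?G \<cdot> inv_ar K ?a))"
    using assoc_natural[OF f g h] cmp_assoc[OF i(1) G a'] by simp
  also have "\<dots> = ?G \<cdot> inv_ar K ?a"
    using cmp_assoc[OF cmp_Hom[OF i(1) G] a' i'(1)] i'(2) cmp_ide_left[OF cmp_Hom[OF i(1) G]] by simp
  finally show ?thesis .
qed

text \<open>Given \<open>ev : D \<otimes> A \<rightarrow> 1\<close>, the arrow \<open>k : 1 \<rightarrow> A \<otimes> Y\<close> is sent to
  \<open>D \<cong> D \<otimes> 1 \<rightarrow> D \<otimes> (A \<otimes> Y) \<cong> (D \<otimes> A) \<otimes> Y \<rightarrow> 1 \<otimes> Y \<cong> Y\<close>: one half of the adjunction between \<open>D \<otimes> -\<close> and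
  \<open>A \<otimes> -\<close>, evaluated at the unit.\<close>

definition transpose :: "'o \<Rightarrow> 'o \<Rightarrow> 'm \<Rightarrow> 'o \<Rightarrow> 'm \<Rightarrow> 'm" where
  "transpose A D ev Y k =
    (lunit K Y \<cdot> ((ev \<boxdot> ide K Y) \<cdot> inv_ar K (assoc K D A Y))) \<cdot> ((ide K D \<boxdot> k) \<cdot> inv_ar K (runit K D))"

lemma transpose_hom:
  assumes ob: "A \<in> ob K" "D \<in> ob K" "Y \<in> ob K" and ev: "ev \<in> Hom K (D \<boxtimes> A) \<I>"
  shows "transpose A D ev Y \<in> hom (hom_group K \<I> (A \<boxtimes> Y)) (hom_group K D Y)"
    and "lunit K Y \<cdot> ((ev \<boxdot> ide K Y) \<cdot> inv_ar K (assoc K D A Y)) \<in> Hom K (D \<boxtimes> (A \<boxtimes> Y)) Y"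
proof -
  show E: "lunit K Y \<cdot> ((ev \<boxdot> ide K Y) \<cdot> inv_ar K (assoc K D A Y)) \<in> Hom K (D \<boxtimes> (A \<boxtimes> Y)) Y"
    by (intro cmp_Hom[OF cmp_Hom[OF inv_ar_Hom(1)[OF assoc_iso assoc_Hom] tensor_Hom[OF ev ide_Hom]] lunit_Hom] ob)
  have "inv_ar K (runit K D) \<in> Hom K D (D \<boxtimes> \<I>)"
    using inv_ar_Hom(1)[OF runit_iso runit_Hom] ob by blast
  note pre = precompose_hom[OF _ this] and post = postcompose_hom[OF ob(2) E]
  note tens = additive_endofunctor_hom[OF tensor_additive_right[OF ob(2)] unit_ob tensor_ob[OF ob(1,3)]]
  have "(\<lambda>x. (lunit K Y \<cdot> ((ev \<boxdot> ide K Y) \<cdot> inv_ar K (assoc K D A Y))) \<cdot> x)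
      \<circ> ((\<lambda>x. x \<cdot> inv_ar K (runit K D)) \<circ> (\<lambda>f. ide K D \<boxdot> f))
      \<in> hom (hom_group K \<I> (A \<boxtimes> Y)) (hom_group K D Y)"
    using hom_compose[OF hom_compose[OF tens pre] post] tensor_ob ob by blast
  then show "transpose A D ev Y \<in> hom (hom_group K \<I> (A \<boxtimes> Y)) (hom_group K D Y)"
    by (simp add: transpose_def[abs_def] o_def)
qed

lemma transpose_natural:
  assumes ob: "A \<in> ob K" "D \<in> ob K" and ev: "ev \<in> Hom K (D \<boxtimes> A) \<I>"
    and y: "y \<in> Hom K Y Y'" and k: "k \<in> Hom K \<I> (A \<boxtimes> Y)"
  shows "transpose A D ev Y' ((ide K A \<boxdot> y) \<cdot> k) = y \<cdot> transpose A D ev Y k"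
proof -
  have Y: "Y \<in> ob K" and Y': "Y' \<in> ob K" using y Hom_ob by blast+
  note idA = ide_Hom[OF ob(1)] and idD = ide_Hom[OF ob(2)] and idY = ide_Hom[OF Y]
  let ?i = "inv_ar K (assoc K D A Y)" and ?i' = "inv_ar K (assoc K D A Y')"
  let ?E = "lunit K Y \<cdot> ((ev \<boxdot> ide K Y) \<cdot> ?i)" and ?E' = "lunit K Y' \<cdot> ((ev \<boxdot> ide K Y') \<cdot> ?i')"
  let ?y = "ide K D \<boxdot> (ide K A \<boxdot> y)" and ?r = "inv_ar K (runit K D)"
  have i: "?i \<in> Hom K (D \<boxtimes> (A \<boxtimes> Y)) ((D \<boxtimes> A) \<boxtimes> Y)" and i': "?i' \<in> Hom K (D \<boxtimes> (A \<boxtimes> Y')) ((D \<boxtimes> A) \<boxtimes> Y')"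
    using inv_ar_Hom(1)[OF assoc_iso assoc_Hom] ob Y Y' by blast+
  have evY: "ev \<boxdot> ide K Y \<in> Hom K ((D \<boxtimes> A) \<boxtimes> Y) (\<I> \<boxtimes> Y)" "ev \<boxdot> ide K Y' \<in> Hom K ((D \<boxtimes> A) \<boxtimes> Y') (\<I> \<boxtimes> Y')"
    using tensor_Hom ev ide_Hom Y Y' by auto
  have yH: "?y \<in> Hom K (D \<boxtimes> (A \<boxtimes> Y)) (D \<boxtimes> (A \<boxtimes> Y'))" using tensor_Hom idA idD y by blast
  have iy: "ide K (D \<boxtimes> A) \<boxdot> y \<in> Hom K ((D \<boxtimes> A) \<boxtimes> Y) ((D \<boxtimes> A) \<boxtimes> Y')"
    using tensor_Hom[OF ide_Hom y] tensor_ob ob by blast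
  have Iy: "ide K \<I> \<boxdot> y \<in> Hom K (\<I> \<boxtimes> Y) (\<I> \<boxtimes> Y')" using tensor_Hom[OF ide_Hom[OF unit_ob] y] .
  have r: "?r \<in> Hom K D (D \<boxtimes> \<I>)" using inv_ar_Hom(1)[OF runit_iso runit_Hom] ob by blast
  have swap: "(ev \<boxdot> ide K Y') \<cdot> (ide K (D \<boxtimes> A) \<boxdot> y) = (ide K \<I> \<boxdot> y) \<cdot> (ev \<boxdot> ide K Y)"
    using tensor_cmp[OF ide_Hom[OF tensor_ob[OF ob(2,1)]] ev y ide_Hom[OF Y']]
      tensor_cmp[OF ev ide_Hom[OF unit_ob] idY y]
      cmp_ide_left[OF y] cmp_ide_right[OF y] cmp_ide_left[OF ev] cmp_ide_right[OF ev] by simp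
  have E: "?E' \<cdot> ?y = y \<cdot> ?E"
  proof -
    have "?E' \<cdot> ?y = lunit K Y' \<cdot> ((ev \<boxdot> ide K Y') \<cdot> (?i' \<cdot> ?y))"
      using cmp_assoc[OF yH cmp_Hom[OF i' evY(2)] lunit_Hom[OF Y']] cmp_assoc[OF yH i' evY(2)] by simp
    also have "\<dots> = lunit K Y' \<cdot> ((ev \<boxdot> ide K Y') \<cdot> ((ide K (D \<boxtimes> A) \<boxdot> y) \<cdot> ?i))"
      using inv_assoc_natural[OF idD idA y] tensor_ide[OF ob(2,1)] by simp
    also have "\<dots> = lunit K Y' \<cdot> ((ide K \<I> \<boxdot> y) \<cdot> ((ev \<boxdot> ide K Y) \<cdot> ?i))"
      using cmp_assoc[OF i iy evY(2)] swap cmp_assoc[OF i evY(1) Iy] by simp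
    also have "\<dots> = y \<cdot> ?E"
      using cmp_assoc[OF cmp_Hom[OF i evY(1)] Iy lunit_Hom[OF Y']] lunit_natural[OF y]
        cmp_assoc[OF cmp_Hom[OF i evY(1)] lunit_Hom[OF Y] y] by simp
    finally show ?thesis .
  qed
  have kH: "ide K D \<boxdot> k \<in> Hom K (D \<boxtimes> \<I>) (D \<boxtimes> (A \<boxtimes> Y))" using tensor_Hom[OF idD k] .
  have "ide K D \<boxdot> ((ide K A \<boxdot> y) \<cdot> k) = ?y \<cdot> (ide K D \<boxdot> k)"
    using tensor_cmp[OF idD idD k tensor_Hom[OF idA y]] cmp_ide_left[OF idD] by simp
  then have "transpose A D ev Y' ((ide K A \<boxdot> y) \<cdot> k) = ?E' \<cdot> (?y \<cdot> ((ide K D \<boxdot> k) \<cdot> ?r))"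
    using cmp_assoc[OF r kH yH] by (simp add: transpose_def)
  also have "\<dots> = (y \<cdot> ?E) \<cdot> ((ide K D \<boxdot> k) \<cdot> ?r)"
    using cmp_assoc[OF cmp_Hom[OF r kH] yH transpose_hom(2)[OF ob Y' ev]] E by simp
  also have "\<dots> = y \<cdot> transpose A D ev Y k"
    using cmp_assoc[OF cmp_Hom[OF r kH] transpose_hom(2)[OF ob Y ev] y] by (simp add: transpose_def)
  finally show ?thesis .
qed

text \<open>This is the triangle identity for \<open>D\<close>. With naturality it says that \<^const>\<open>transpose\<close> retracts
  \<open>Hom(D, Y) \<rightarrow> Hom(1, A \<otimes> Y)\<close>, \<open>h \<mapsto> (1 \<otimes> h) cv\<close>.\<close>

lemma transpose_coevaluation:
  assumes ob: "A \<in> ob K" "D \<in> ob K" and ev: "ev \<in> Hom K (D \<boxtimes> A) \<I>" and cv: "cv \<in> Hom K \<I> (A \<boxtimes> D)"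
    and eq: "lunit K D \<cdot> (ev \<boxdot> ide K D) \<cdot> inv_ar K (assoc K D A D) \<cdot> (ide K D \<boxdot> cv) = runit K D"
  shows "transpose A D ev D cv = ide K D"
proof -
  note r = inv_ar_Hom[OF runit_iso runit_Hom, OF ob(2) ob(2)]
  note i = inv_ar_Hom(1)[OF assoc_iso[OF ob(2,1,2)] assoc_Hom[OF ob(2,1,2)]]
  note evD = tensor_Hom[OF ev ide_Hom[OF ob(2)]]
  note cvD = tensor_Hom[OF ide_Hom[OF ob(2)] cv]
  have "transpose A D ev D cv
      = ((lunit K D \<cdot> ((ev \<boxdot> ide K D) \<cdot> inv_ar K (assoc K D A D))) \<cdot> (ide K D \<boxdot> cv)) \<cdot> inv_ar K (runit K D)"
    using cmp_assoc[OF r(1) cvD transpose_hom(2)[OF ob ob(2) ev]] by (simp add: transpose_def)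
  also have "\<dots> = runit K D \<cdot> inv_ar K (runit K D)"
    using cmp_assoc[OF cvD cmp_Hom[OF i evD] lunit_Hom[OF ob(2)]] cmp_assoc[OF cvD i evD] eq by simp
  finally show ?thesis using r(3) by simp
qed

end

context compactly_generated_ttc
begin

lemma compact_ob: "A \<in> compact_objects K U \<Longrightarrow> A \<in> ob K"
  by (simp add: compact_objects_def)

text \<open>\<open>Hom(D, -)\<close> is a retract of \<open>Hom(1, A \<otimes> -)\<close>, the unit is compact, and \<open>A \<otimes> -\<close> preserves
  coproducts. The retraction is \<^const>\<open>transpose\<close>.\<close>

lemma dual_compact:
  assumes ob: "A \<in> ob K" "D \<in> ob K" and ev: "ev \<in> Hom K (D \<boxtimes> A) \<I>" and cv: "cv \<in> Hom K \<I> (A \<boxtimes> D)"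
    and eq: "lunit K D \<cdot> (ev \<boxdot> ide K D) \<cdot> inv_ar K (assoc K D A D) \<cdot> (ide K D \<boxdot> cv) = runit K D"
  shows "D \<in> compact_objects K U"
proof (rule compact_retract[OF ob(2) compact_unit])
  fix I :: "'u set" and X S \<iota>
  assume I: "small U I" and cop: "coproduct K I X S \<iota>"
  have S: "S \<in> ob K" and X: "\<And>i. i \<in> I \<Longrightarrow> X i \<in> ob K" "\<And>i. i \<in> I \<Longrightarrow> \<iota> i \<in> Hom K (X i) S"
    using cop by (auto simp: coproduct_def)
  note idA = ide_Hom[OF ob(1)]
  define \<phi> where "\<phi> h = (ide K A \<boxdot> h) \<cdot> cv" for h
  define \<psi> where "\<psi> = transpose A D ev"
  have \<phi>: "\<phi> \<in> hom (hom_group K D Y) (hom_group K \<I> (A \<boxtimes> Y))" if "Y \<in> ob K" for Y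
    using hom_compose[OF additive_endofunctor_hom[OF tensor_additive_right[OF ob(1)] ob(2) that]
        precompose_hom[OF tensor_ob[OF ob(1) that] cv]]
    by (simp add: \<phi>_def[abs_def] o_def)
  have \<psi>: "\<psi> Y \<in> hom (hom_group K \<I> (A \<boxtimes> Y)) (hom_group K D Y)" if "Y \<in> ob K" for Y
    using transpose_hom(1)[OF ob that ev] by (simp add: \<psi>_def)
  have \<psi>\<phi>: "\<psi> Y (\<phi> h) = h" if h: "h \<in> Hom K D Y" for Y h
    using transpose_natural[OF ob ev h cv] transpose_coevaluation[OF ob ev cv eq] cmp_ide_right[OF h]
    by (simp add: \<phi>_def \<psi>_def)
  show "hom_retract K D \<I> I X S \<iota>"
    unfolding hom_retract_def
  proof (intro exI conjI ballI)
    show "coproduct K I (\<lambda>i. A \<boxtimes> X i) (A \<boxtimes> S) (\<lambda>i. ide K A \<boxdot> \<iota> i)"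
      by (rule tensor_coproduct_right[OF I cop ob(1)])
    show "\<phi> \<in> hom (hom_group K D (X i)) (hom_group K \<I> (A \<boxtimes> X i))"
      "\<psi> (X i) \<in> hom (hom_group K \<I> (A \<boxtimes> X i)) (hom_group K D (X i))" if "i \<in> I" for i
      using \<phi> \<psi> X(1)[OF that] by auto
    show "\<psi> (X i) (\<phi> h) = h" if "i \<in> I" "h \<in> Hom K D (X i)" for i h using \<psi>\<phi>[OF that(2)] .
    show "\<phi> (\<iota> i \<cdot> h) = (ide K A \<boxdot> \<iota> i) \<cdot> \<phi> h" if "i \<in> I" "h \<in> Hom K D (X i)" for i h
      using tensor_cmp[OF idA idA that(2) X(2)[OF that(1)]] cmp_ide_left[OF idA]
        cmp_assoc[OF cv tensor_Hom[OF idA that(2)] tensor_Hom[OF idA X(2)[OF that(1)]]]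
      by (simp add: \<phi>_def)
    show "\<psi> S ((ide K A \<boxdot> \<iota> i) \<cdot> k) = \<iota> i \<cdot> \<psi> (X i) k" if "i \<in> I" "k \<in> Hom K \<I> (A \<boxtimes> X i)" for i k
      using transpose_natural[OF ob ev X(2)[OF that(1)] that(2)] by (simp add: \<psi>_def)
    show "\<phi> \<in> hom (hom_group K D S) (hom_group K \<I> (A \<boxtimes> S))"
      "\<psi> S \<in> hom (hom_group K \<I> (A \<boxtimes> S)) (hom_group K D S)" using \<phi> \<psi> S by auto
    show "\<psi> S (\<phi> h) = h" if "h \<in> Hom K D S" for h using \<psi>\<phi>[OF that] .
  qed
qed

section \<open>Thick tensor ideals\<close>

lemma thick_isomorphic:
  "thick_tensor_ideal K U T \<Longrightarrow> A \<in> T \<Longrightarrow> isomorphic K A B \<Longrightarrow> B \<in> T"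
  unfolding thick_tensor_ideal_def tensor_ideal_def triangulated_subcategory_def by blast

lemma thick_tensor:
  assumes "thick_tensor_ideal K U T" "A \<in> T" "B \<in> compact_objects K U"
  shows "A \<boxtimes> B \<in> T" "B \<boxtimes> A \<in> T"
  using assms unfolding thick_tensor_ideal_def tensor_ideal_def by blast+

text \<open>The functor \<open>- \<otimes> B\<close> is exact, preserves compactness and commutes, up to isomorphism, with the shift
  and with tensoring by a further object (on the right, through the braiding), so the preimage of a thick tensor ideal under it is one.\<close>

lemma thick_quotient:
  assumes T: "thick_tensor_ideal K U T" and B: "B \<in> compact_objects K U"
  shows "thick_tensor_ideal K U {A \<in> compact_objects K U. A \<boxtimes> B \<in> T}" (is "thick_tensor_ideal K U ?S")
proof -
  note Bob = compact_ob[OF B]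
  have Tc: "T \<subseteq> compact_objects K U" and Tz: "\<And>Z. zero_object K Z \<Longrightarrow> Z \<in> T"
    and Tshift: "\<And>A. A \<in> compact_objects K U \<Longrightarrow> shift K A \<in> T \<longleftrightarrow> A \<in> T"
    and Ttri: "\<And>A B C. compact_triangle K U A B C \<Longrightarrow>
        (A \<in> T \<and> B \<in> T \<longrightarrow> C \<in> T) \<and> (B \<in> T \<and> C \<in> T \<longrightarrow> A \<in> T) \<and> (A \<in> T \<and> C \<in> T \<longrightarrow> B \<in> T)"
    and Tsum: "\<And>A B. B \<in> T \<Longrightarrow> A \<in> compact_objects K U \<Longrightarrow> direct_summand K A B \<Longrightarrow> A \<in> T"
    using T unfolding thick_tensor_ideal_def tensor_ideal_def triangulated_subcategory_def by blast+
  from tensor_exact_left[OF Bob] obtain \<theta> where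
    \<theta>: "natural_iso K ((\<lambda>X. X \<boxtimes> B) \<circ> shift K) ((\<lambda>f. f \<boxdot> ide K B) \<circ> shift_ar K)
          (shift K \<circ> (\<lambda>X. X \<boxtimes> B)) (shift_ar K \<circ> (\<lambda>f. f \<boxdot> ide K B)) \<theta>"
    and ex: "\<And>f g h. (f, g, h) \<in> dist K \<Longrightarrow>
          (f \<boxdot> ide K B, g \<boxdot> ide K B, \<theta> (src K f) \<cdot> (h \<boxdot> ide K B)) \<in> dist K"
    unfolding exact_endofunctor_def by blast
  have \<theta>H: "\<theta> A \<in> Hom K (shift K A \<boxtimes> B) (shift K (A \<boxtimes> B))" "is_iso K (\<theta> A)" if "A \<in> ob K" for A
    using \<theta> that by (auto simp: natural_iso_def)
  have tri: "compact_triangle K U (A \<boxtimes> B) (C \<boxtimes> B) (E \<boxtimes> B)" if ACE: "compact_triangle K U A C E" for A C E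
  proof -
    obtain f g h where D: "(f, g, h) \<in> dist K" and s: "src K f = A" "src K g = C" "src K h = E"
      using ACE by (auto simp: compact_triangle_def)
    note H = dist_Hom[OF D, unfolded s]
    have A: "A \<in> ob K" using H Hom_ob by blast
    have "f \<boxdot> ide K B \<in> Hom K (A \<boxtimes> B) (C \<boxtimes> B)" "g \<boxdot> ide K B \<in> Hom K (C \<boxtimes> B) (E \<boxtimes> B)"
        "h \<boxdot> ide K B \<in> Hom K (E \<boxtimes> B) (shift K A \<boxtimes> B)"
      using tensor_Hom[OF _ ide_Hom[OF Bob]] H by blast+
    then have "src K (f \<boxdot> ide K B) = A \<boxtimes> B" "src K (g \<boxdot> ide K B) = C \<boxtimes> B"
        "src K (\<theta> A \<cdot> (h \<boxdot> ide K B)) = E \<boxtimes> B"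
      using cmp_Hom[OF _ \<theta>H(1)[OF A]] by (auto simp: Hom_def)
    moreover have "A \<in> compact_objects K U" "C \<in> compact_objects K U" "E \<in> compact_objects K U"
      using ACE by (auto simp: compact_triangle_def)
    ultimately show ?thesis
      unfolding compact_triangle_def using ex[OF D] s(1) compact_tensor[OF _ B] by metis
  qed
  have S_zero: "Z \<in> ?S" if "zero_object K Z" for Z
    using additive_endofunctor_zero_object[OF tensor_additive_left[OF Bob] that] Tz that Tc by auto
  have S_iso: "C \<in> ?S" if "A \<in> ?S" "isomorphic K A C" for A C
    using that compact_isomorphic[of A U C] tensor_isomorphic_left[OF Bob] thick_isomorphic[OF T] by blast
  have S_shift: "shift K A \<in> ?S \<longleftrightarrow> A \<in> ?S" if A: "A \<in> compact_objects K U" for A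
  proof -
    have "isomorphic K (shift K A \<boxtimes> B) (shift K (A \<boxtimes> B))"
      using \<theta>H[OF compact_ob[OF A]] by (rule isomorphicI)
    then have "shift K A \<boxtimes> B \<in> T \<longleftrightarrow> A \<boxtimes> B \<in> T"
      using Tshift[OF compact_tensor[OF A B]] thick_isomorphic[OF T] isomorphic_sym by metis
    then show ?thesis using A compact_shift[OF A] by simp
  qed
  have S_tri: "(A \<in> ?S \<and> C \<in> ?S \<longrightarrow> E \<in> ?S) \<and> (C \<in> ?S \<and> E \<in> ?S \<longrightarrow> A \<in> ?S) \<and> (A \<in> ?S \<and> E \<in> ?S \<longrightarrow> C \<in> ?S)"
    if ACE: "compact_triangle K U A C E" for A C E
  proof -
    have "A \<in> compact_objects K U" "C \<in> compact_objects K U" "E \<in> compact_objects K U"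
      using ACE unfolding compact_triangle_def by blast+
    note c = this and t = Ttri[OF tri[OF ACE]]
    show ?thesis
      unfolding mem_Collect_eq using c t by fast
  qed
  have "triangulated_subcategory K U ?S"
    unfolding triangulated_subcategory_def
    by (intro conjI[OF _ conjI[OF _ conjI[OF _ conjI]]] allI ballI impI S_tri S_shift)
      (use S_zero S_iso in blast)+
  moreover have "A \<boxtimes> C \<in> ?S \<and> C \<boxtimes> A \<in> ?S" if A: "A \<in> ?S" and C: "C \<in> compact_objects K U" for A C
  proof -
    have Ac: "A \<in> compact_objects K U" and AB: "A \<boxtimes> B \<in> T" using A by auto
    note ob = compact_ob[OF Ac] compact_ob[OF C] Bob
    have "C \<boxtimes> (A \<boxtimes> B) \<in> T" using thick_tensor(2)[OF T AB C] .
    then have CA: "(C \<boxtimes> A) \<boxtimes> B \<in> T"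
      using thick_isomorphic[OF T] isomorphic_sym[OF assoc_isomorphic[OF ob(2,1,3)]] by blast
    then have "(A \<boxtimes> C) \<boxtimes> B \<in> T"
      using thick_isomorphic[OF T] tensor_isomorphic_left[OF Bob braid_isomorphic[OF ob(2,1)]] by blast
    then show ?thesis using CA compact_tensor Ac C by simp
  qed
  moreover have "A \<in> ?S" if "C \<in> ?S" "A \<in> compact_objects K U" "direct_summand K A C" for A C
    using Tsum[of "C \<boxtimes> B" "A \<boxtimes> B"] compact_tensor[OF that(2) B] that
      additive_endofunctor_direct_summand[OF tensor_additive_left[OF Bob] that(3)] by simp
  ultimately show ?thesis unfolding thick_tensor_ideal_def tensor_ideal_def by blast
qed

text \<open>Rigidity enters here. With \<open>D\<close> the dual of \<open>A\<close>, the triangle identity for \<open>A\<close> makes \<open>A\<close> a retract of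
  \<open>(A \<otimes> D) \<otimes> A\<close>, which by the braiding is isomorphic to \<open>D \<otimes> (A \<otimes> A)\<close>. The latter lies in the ideal, because
  \<open>D\<close> is compact.\<close>

lemma thick_radical:
  assumes T: "thick_tensor_ideal K U T" and A: "A \<in> compact_objects K U" and AA: "A \<boxtimes> A \<in> T"
  shows "A \<in> T"
proof -
  note Aob = compact_ob[OF A]
  obtain D ev cv where D: "D \<in> ob K" and ev: "ev \<in> Hom K (D \<boxtimes> A) \<I>" and cv: "cv \<in> Hom K \<I> (A \<boxtimes> D)"
    and eq1: "runit K A \<cdot> (ide K A \<boxdot> ev) \<cdot> assoc K A D A \<cdot> (cv \<boxdot> ide K A) = lunit K A"
    and eq2: "lunit K D \<cdot> (ev \<boxdot> ide K D) \<cdot> inv_ar K (assoc K D A D) \<cdot> (ide K D \<boxdot> cv) = runit K D"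
    using compact_rigid[OF A] unfolding rigid_def by blast
  have Dc: "D \<in> compact_objects K U" by (rule dual_compact[OF Aob D ev cv eq2])
  have "D \<boxtimes> (A \<boxtimes> A) \<in> T" by (rule thick_tensor(2)[OF T AA Dc])
  then have "(D \<boxtimes> A) \<boxtimes> A \<in> T"
    using thick_isomorphic[OF T] isomorphic_sym[OF assoc_isomorphic[OF D Aob Aob]] by blast
  then have ADA: "(A \<boxtimes> D) \<boxtimes> A \<in> T"
    using thick_isomorphic[OF T] tensor_isomorphic_left[OF Aob braid_isomorphic[OF D Aob]] by blast
  note l = inv_ar_Hom[OF lunit_iso[OF Aob] lunit_Hom[OF Aob]]
  note cvA = tensor_Hom[OF cv ide_Hom[OF Aob]] and evA = tensor_Hom[OF ide_Hom[OF Aob] ev]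
  note a = assoc_Hom[OF Aob D Aob] and ru = runit_Hom[OF Aob]
  let ?s = "(cv \<boxdot> ide K A) \<cdot> inv_ar K (lunit K A)"
  let ?r = "runit K A \<cdot> ((ide K A \<boxdot> ev) \<cdot> assoc K A D A)"
  have s: "?s \<in> Hom K A ((A \<boxtimes> D) \<boxtimes> A)" by (rule cmp_Hom[OF l(1) cvA])
  have r: "?r \<in> Hom K ((A \<boxtimes> D) \<boxtimes> A) A" by (rule cmp_Hom[OF cmp_Hom[OF a evA] ru])
  have "?r \<cdot> (cv \<boxdot> ide K A) = lunit K A"
    using cmp_assoc[OF cvA cmp_Hom[OF a evA] ru] cmp_assoc[OF cvA a evA] eq1 by simp
  then have "?r \<cdot> ?s = ide K A"
    using cmp_assoc[OF l(1) cvA r] l(3) by simp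
  then have "direct_summand K A ((A \<boxtimes> D) \<boxtimes> A)" by (rule split_mono_direct_summand[OF s r])
  then show ?thesis using T ADA A unfolding thick_tensor_ideal_def by blast
qed

text \<open>Fix a thick tensor ideal \<open>T\<close> containing \<open>M \<otimes> N\<close>. The quotient ideal of \<open>T\<close> by \<open>N\<close> contains \<open>M\<close>, hence \<open>L\<close>;
  so \<open>N \<otimes> L\<close> is in \<open>T\<close>, the quotient ideal of \<open>T\<close> by \<open>L\<close> contains \<open>N\<close>, hence \<open>L\<close>; so \<open>L \<otimes> L\<close> is in \<open>T\<close>.\<close>

lemma Tensor_inter_subset_Tensor_tensor:
  assumes "L \<in> Tensor K U M" "L \<in> Tensor K U N" and M: "M \<in> compact_objects K U" and N: "N \<in> compact_objects K U"
  shows "L \<in> Tensor K U (M \<boxtimes> N)"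
  unfolding Tensor_def
proof (intro CollectI conjI allI impI)
  show L: "L \<in> compact_objects K U" using assms by (simp add: Tensor_def)
  fix T assume "thick_tensor_ideal K U T \<and> M \<boxtimes> N \<in> T"
  then have T: "thick_tensor_ideal K U T" and MN: "M \<boxtimes> N \<in> T" by auto
  have "L \<in> {A \<in> compact_objects K U. A \<boxtimes> N \<in> T}"
    using assms(1) thick_quotient[OF T N] M MN by (auto simp: Tensor_def)
  then have "N \<boxtimes> L \<in> T"
    using thick_isomorphic[OF T] braid_isomorphic[OF compact_ob[OF L] compact_ob[OF N]] by blast
  then have "L \<in> {A \<in> compact_objects K U. A \<boxtimes> L \<in> T}"
    using assms(2) thick_quotient[OF T L] N by (auto simp: Tensor_def)
  then show "L \<in> T" using thick_radical[OF T L] by simp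
qed

end

theorem proposition2p7p2:
  fixes K :: "('o, 'm) tensor_triangulated_data" and U :: "'u set"
    and X :: "'x topology" and V :: "'o \<Rightarrow> 'x set"
  assumes "compactly_generated_ttc K U"
    and "zariski_space X"
    and "quasi_support_data K U X V"
    and "\<And>M. M \<in> compact_objects K U \<Longrightarrow> support_ideal K U V (V M) = Tensor K U M"
    and "\<And>W. closedin X W \<Longrightarrow> \<exists>M \<in> compact_objects K U. V M = W"
  shows "\<And>M N. M \<in> compact_objects K U \<Longrightarrow> N \<in> compact_objects K U
    \<Longrightarrow> V (tensor K M N) = V M \<inter> V N"
proof -
  fix M N assume M: "M \<in> compact_objects K U" and N: "N \<in> compact_objects K U"
  interpret compactly_generated_ttc K U by fact
  interpret V: quasi_support_data K U X V by fact
  have "closedin X (V M \<inter> V N)" using V.closed M N by blast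
  then obtain L where L: "L \<in> compact_objects K U" "V L = V M \<inter> V N" using assms(5) by blast
  then have "L \<in> support_ideal K U V (V M)" "L \<in> support_ideal K U V (V N)"
    by (auto simp: support_ideal_def)
  then have "L \<in> Tensor K U (tensor K M N)"
    using Tensor_inter_subset_Tensor_tensor M N assms(4) by blast
  then have "L \<in> support_ideal K U V (V (tensor K M N))"
    using assms(4)[OF compact_tensor[OF M N]] by simp
  then have "V M \<inter> V N \<subseteq> V (tensor K M N)" using L by (simp add: support_ideal_def)
  then show "V (tensor K M N) = V M \<inter> V N" using V.tensor[OF M N] by blast
qed

end
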